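(* For each real $p$ with $0 < p \le 2$ there exists a constant $C_p' < \infty$ such that for all $f \in H^p(\mathbb{T})$, with Taylor expansion $f(z) = a_0 + a_1 z + a_2 z^2 + \ldots$ (so $a_0 = f(0)$ and $a_1 = f'(0)$), we have $$\|f(z) - f(0) - f'(0)z\|_p^2 \le C_p'\left(\|f\|_p^2 - |a_0|^2 - \frac{p}{2}|a_1|^2\right).$$
   Context: $H^p(\mathbb{T})$ is the Hardy space of the unit circle, identified with the space of analytic functions $f$ on the open unit disc $\mathbb{D}$ such that $\|f\|_p = \sup_{0<r<1}\left(\frac{1}{2\pi}\int_0^{2\pi}|f(re^{it})|^p\,dt\right)^{1/p} < \infty$ (equivalently, $\|f\|_p$ is the $L^p$ norm of the boundary values with respect to normalized arc length; for $p<1$ it is only a quasi-norm). The notation $\|f(z) - f(0) - f'(0)z\|_p$ means the $H^p$ norm of the function $z \mapsto f(z) - f(0) - f'(0)z$. The constant $C_p'$ depends only on $p$. *)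

theory Defs
  imports "HOL-Complex_Analysis.Complex_Analysis"
begin

definition circle_mean :: "real \<Rightarrow> (complex \<Rightarrow> complex) \<Rightarrow> real \<Rightarrow> real" where
  "circle_mean p f r =
     (1 / (2 * pi) * (LINT t:{0..2*pi}|lborel. cmod (f (of_real r * cis t)) powr p)) powr (1 / p)"

text \<open>
  Functions are total on the complex plane, but only their values on the open unit disc matter.
  On the disc they are holomorphic, hence each integral above is that of a continuous function
  on a compact interval; finiteness of the norm is boundedness of the means.
\<close>

definition hardy_space :: "real \<Rightarrow> (complex \<Rightarrow> complex) set" where
  "hardy_space p =
     {f. f holomorphic_on ball 0 1 \<and> bdd_above (circle_mean p f ` {0<..<1})}"

text \<open>
  A real-valued supremum, meaningful for members of \<^const>\<open>hardy_space\<close> only. For \<open>p > 0\<close> that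
  space is closed under addition and contains all polynomials.
\<close>

definition hardy_norm :: "real \<Rightarrow> (complex \<Rightarrow> complex) \<Rightarrow> real" where
  "hardy_norm p f = (SUP r\<in>{0<..<1}. circle_mean p f r)"

end

theory Submission
  imports Defs
begin

text \<open>
  Put \<open>s = 2 / p\<close>. By rescaling, it is enough to treat functions that are holomorphic on the closed
  unit disc and have no zeros on the unit circle, provided that the constant does not depend on the
  radius. Such a function is \<open>f = B * exp L\<close> with \<open>B\<close> a finite Blaschke product. Write
  \<open>d = 1 - |B(0)|\<^sup>2\<close>, \<open>b = L'(0) / s\<close>, \<open>X = |exp (L(0))|\<^sup>p\<close>, and let \<open>A\<close> be the average of \<open>|f|\<^sup>p\<close> over the
  circle. Since \<open>|f|\<^sup>p = |exp (L / s)|\<^sup>2\<close> there, Bessel's inequality gives \<open>A \<ge> X (1 + |b|\<^sup>2)\<close>; let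
  \<open>R = A / X - 1 - |b|\<^sup>2\<close> be its gap.

  The quantity \<open>\<parallel>f\<parallel>\<^sup>2 - |f(0)|\<^sup>2 - (p/2) |f'(0)|\<^sup>2\<close>, called the deficit below, is at least \<open>X\<^sup>s\<close> times
  \<open>(1 - 1/s) d + (1 + |b|\<^sup>2 + R)\<^sup>s - 1 - s |b|\<^sup>2\<close>; this uses \<open>|B'(0)| \<le> d\<close> and the minimum of a quadratic
  polynomial in \<open>|b|\<close> (\<open>deficit_lower_bound\<close>). For \<open>p < 2\<close> we have \<open>s > 1\<close>, and all three parameters are
  under control: either \<open>|b|\<^sup>2 + R \<ge> 1/4\<close>, and the deficit is comparable to \<open>\<parallel>f\<parallel>\<^sup>2\<close>, so that the triangle
  inequality suffices, or the deficit dominates \<open>X\<^sup>s\<close> times each of \<open>d\<close>, \<open>R\<close> and \<open>|b|\<^sup>4\<close>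
  (\<open>deficit_dominates\<close>).

  In the second case \<open>exp L\<close> is compared with \<open>exp (L(0)) (1 + b z)\<^sup>s\<close>, the function with the same
  \<open>L'(0)\<close> for which \<open>R = 0\<close>. The comparison rests on the strict convexity of \<open>|1 + w|\<^sup>q\<close>, which
  requires \<open>q > 1\<close>: choose \<open>n\<close> with \<open>q = n p \<in> (1, 2]\<close> and define \<open>W\<close> by \<open>exp ((L - L(0)) / n) = (1 + b z)\<^bsup>s/n\<^esup> (1 + W)\<close>, so that
  \<open>|f|\<^sup>p / X = |1 + b z|\<^sup>2 |1 + W|\<^sup>q\<close> on the circle. Now \<open>|1 + w|\<^sup>q\<close> exceeds its linear part \<open>1 + q Re w\<close> by a
  multiple of \<open>|w|\<^sup>2 (1 + |w|)\<^bsup>q-2\<^esup>\<close>, and the linear part contributes nothing: \<open>W\<close> vanishes to second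
  order at 0, while \<open>|1 + b z|\<^sup>2\<close> has only frequencies \<open>-1, 0, 1\<close>. Hence \<open>R\<close> dominates the average of
  \<open>|W|\<^sup>2 (1 + |W|)\<^bsup>q-2\<^esup>\<close> (\<open>convexity_remainder_le_Bessel_gap\<close>). What remains of \<open>f(z) - f(0) - f'(0) z\<close> consists of
  \<open>B - B(0)\<close>, whose mean square is \<open>d\<close>, of terms in \<open>W\<close>, and of quantities of size \<open>d + |b|\<^sup>2\<close>; each of them
  has \<open>p\<close>-norm at most a constant times the square root of the deficit.

  For \<open>p = 2\<close> the coefficient \<open>1 - 1/s\<close> vanishes, but then the claim is Parseval's identity. To return to
  the Hardy norm, let the radius tend to 1 in the right-hand side. On the left-hand side this gives the
  supremum over all radii, because the means of a holomorphic function increase with the radius; that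
  again follows from the factorization, which reduces it to the mean square of \<open>exp (L / s)\<close>.
\<close>

section \<open>Averages over the unit circle\<close>

definition circle_average :: "(complex \<Rightarrow> 'a::euclidean_space) \<Rightarrow> 'a" where
  "circle_average u = integral {0..2*pi} (\<lambda>t. u (cis t)) /\<^sub>R (2*pi)"

lemma integrable_on_circle:
  fixes u :: "complex \<Rightarrow> 'a::euclidean_space"
  assumes "continuous_on (sphere 0 1) u"
  shows "(\<lambda>t. u (cis t)) integrable_on {a..b}"
  by (rule integrable_continuous_real)
     (intro continuous_on_compose2[OF assms] continuous_intros, auto)

lemma circle_average_add:
  assumes "continuous_on (sphere 0 1) u" "continuous_on (sphere 0 1) v"
  shows "circle_average (\<lambda>z. u z + v z) = circle_average u + circle_average v"
  unfolding circle_average_def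
  by (simp add: integral_add[OF integrable_on_circle[OF assms(1)] integrable_on_circle[OF assms(2)]] scaleR_add_right)

lemma circle_average_mult_left:
  fixes u :: "complex \<Rightarrow> 'a::{euclidean_space,real_normed_field}"
  shows "circle_average (\<lambda>z. c * u z) = c * circle_average u"
  unfolding circle_average_def by simp

lemma circle_average_mono:
  fixes u v :: "complex \<Rightarrow> real"
  assumes "continuous_on (sphere 0 1) u" "continuous_on (sphere 0 1) v"
    and "\<And>z. cmod z = 1 \<Longrightarrow> u z \<le> v z"
  shows "circle_average u \<le> circle_average v"
  unfolding circle_average_def
  by (simp add: divide_simps, rule integral_le) (use assms integrable_on_circle in auto)

lemma circle_average_nonneg:
  fixes u :: "complex \<Rightarrow> real"
  assumes "continuous_on (sphere 0 1) u" and "\<And>z. cmod z = 1 \<Longrightarrow> 0 \<le> u z"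
  shows "0 \<le> circle_average u"
  unfolding circle_average_def
  using integral_nonneg[OF integrable_on_circle[OF assms(1)], of 0 "2*pi"] assms(2) by simp

lemma circle_average_cong:
  assumes "\<And>z. cmod z = 1 \<Longrightarrow> u z = v z"
  shows "circle_average u = circle_average v"
  unfolding circle_average_def using assms by (simp cong: integral_cong)

lemma circle_average_const [simp]: "circle_average (\<lambda>_. c) = c"
  unfolding circle_average_def by simp

lemma circle_average_Re:
  assumes "continuous_on (sphere 0 1) u"
  shows "circle_average (\<lambda>z. Re (u z)) = Re (circle_average u)"
  unfolding circle_average_def
  using integral_linear[OF integrable_on_circle[OF assms] bounded_linear_Re, of 0 "2*pi"]
  by (simp add: o_def)

lemma circle_average_div_power:
  assumes "u holomorphic_on cball 0 1"
  shows "circle_average (\<lambda>z. u z / z ^ k) = (deriv ^^ k) u 0 / fact k"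
proof -
  have "((\<lambda>z. u z / (z - 0) ^ Suc k) has_contour_integral
          (2 * pi * \<i>) / (fact k) * (deriv ^^ k) u 0) (part_circlepath 0 1 0 (2*pi))"
    using Cauchy_has_contour_integral_higher_derivative_circlepath[of 0 1 u 0 k]
      holomorphic_on_imp_continuous_on[OF assms] holomorphic_on_subset[OF assms ball_subset_cball]
    by (simp add: circlepath_def)
  then have "((\<lambda>t. u (cis t) / cis t ^ Suc k * \<i> * cis t) has_integral
          (2 * pi * \<i>) / (fact k) * (deriv ^^ k) u 0) {0..2*pi}"
    by (subst (asm) has_contour_integral_part_circlepath_iff) auto
  from has_integral_mult_right[OF this, of "1 / (2 * pi * \<i>)"]
  have "((\<lambda>t. 1 / (2 * pi) * (u (cis t) / cis t ^ k)) has_integral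
          ((deriv ^^ k) u 0) / (fact k)) {0..2*pi}"
    by (simp add: field_simps)
  then have "integral {0..2*pi} (\<lambda>t. 1 / (2 * pi) * (u (cis t) / cis t ^ k)) = ((deriv ^^ k) u 0) / (fact k)"
    by (rule integral_unique)
  then show ?thesis
    unfolding circle_average_def integral_mult_right by (simp add: scaleR_conv_of_real field_simps)
qed

lemma circle_average_holomorphic:
  assumes "u holomorphic_on cball 0 1"
  shows "circle_average u = u 0"
  using circle_average_div_power[OF assms, of 0] by simp

lemma cnj_eq_inverse_on_circle: "cmod z = 1 \<Longrightarrow> cnj z = inverse z"
  by (rule inverse_unique[symmetric]) (simp flip: complex_norm_square)

lemma circle_average_cnj_mult:
  assumes "u holomorphic_on cball 0 1"
  shows "circle_average (\<lambda>z. cnj z * u z) = deriv u 0"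
proof -
  have "circle_average (\<lambda>z. cnj z * u z) = circle_average (\<lambda>z. u z / z ^ 1)"
    by (rule circle_average_cong) (simp add: cnj_eq_inverse_on_circle field_simps)
  also have "\<dots> = deriv u 0" by (subst circle_average_div_power[OF assms]) simp
  finally show ?thesis .
qed

lemma continuous_on_circle:
  assumes "u holomorphic_on cball 0 1"
  shows "continuous_on (sphere 0 1) u"
  using assms holomorphic_on_imp_continuous_on holomorphic_on_subset sphere_cball by blast

text \<open>
  On the circle \<open>|1 + b z|\<^sup>2 = 1 + |b|\<^sup>2 + b z + cnj (b z)\<close>, so that only the Taylor coefficients of
  \<open>w\<close> of order 0 and 1 enter the average.
\<close>

lemma weighted_average_vanishing:
  assumes w: "w holomorphic_on cball 0 1" and "w 0 = 0" "deriv w 0 = 0"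
  shows "circle_average (\<lambda>z. (cmod (1 + b * z))\<^sup>2 * Re (w z)) = 0"
proof -
  note cw [continuous_intros] = continuous_on_circle[OF w]
  define c where "c = complex_of_real (1 + (cmod b)\<^sup>2)"
  have eq: "(cmod (1 + b * z))\<^sup>2 * Re (w z)
      = Re ((c * w z + b * z * w z) + cnj b * (cnj z * w z))" if "cmod z = 1" for z
  proof -
    have "(cmod (b * z))\<^sup>2 = (cmod b)\<^sup>2"
      using that by (simp only: norm_mult power_mult_distrib) simp
    then have "(cmod (1 + b * z))\<^sup>2 = 1 + (cmod b)\<^sup>2 + 2 * Re (b * z)"
      unfolding \<open>(cmod (b * z))\<^sup>2 = (cmod b)\<^sup>2\<close>[symmetric] cmod_power2
      by (simp add: power2_eq_square algebra_simps)
    moreover have "cnj b * (cnj z * w z) = cnj (b * z) * w z" by simp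
    moreover have "Re (b * z * w z) + Re (cnj (b * z) * w z) = 2 * Re (b * z) * Re (w z)"
      by (simp add: algebra_simps)
    moreover have "Re (c * w z) = (1 + (cmod b)\<^sup>2) * Re (w z)"
      by (simp only: c_def times_complex.sel Re_complex_of_real Im_complex_of_real)
    ultimately show ?thesis by (simp only: plus_complex.sel) (simp only: distrib_right)
  qed
  have "circle_average (\<lambda>z. (cmod (1 + b * z))\<^sup>2 * Re (w z))
      = circle_average (\<lambda>z. Re ((c * w z + b * z * w z) + cnj b * (cnj z * w z)))"
    by (rule circle_average_cong) (rule eq)
  also have "\<dots> = Re (circle_average (\<lambda>z. (c * w z + b * z * w z) + cnj b * (cnj z * w z)))"
    by (rule circle_average_Re) (intro continuous_intros)
  also have "circle_average (\<lambda>z. (c * w z + b * z * w z) + cnj b * (cnj z * w z))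
      = circle_average (\<lambda>z. c * w z + b * z * w z) + circle_average (\<lambda>z. cnj b * (cnj z * w z))"
    by (rule circle_average_add) (intro continuous_intros)+
  also have "circle_average (\<lambda>z. c * w z + b * z * w z) = 0"
    by (subst circle_average_holomorphic) (use assms in \<open>auto intro!: holomorphic_intros\<close>)
  also have "circle_average (\<lambda>z. cnj b * (cnj z * w z)) = 0"
    using circle_average_mult_left[of "cnj b" "\<lambda>z. cnj z * w z"] circle_average_cnj_mult[OF w] assms(3) by simp
  finally show ?thesis by simp
qed

text \<open>
  In the mean square, \<open>u 0 + deriv u 0 * z\<close> is the orthogonal projection of \<open>u\<close> onto the affine
  functions; the last two squares are its squared distance from \<open>a + b z\<close>.
\<close>

lemma average_square_minus_Taylor:
  assumes u: "u holomorphic_on cball 0 1"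
  shows "circle_average (\<lambda>z. (cmod (u z - a - b * z))\<^sup>2)
       = circle_average (\<lambda>z. (cmod (u z))\<^sup>2) - (cmod (u 0))\<^sup>2 - (cmod (deriv u 0))\<^sup>2
         + (cmod (u 0 - a))\<^sup>2 + (cmod (deriv u 0 - b))\<^sup>2"
proof -
  note cu [continuous_intros] = continuous_on_circle[OF u]
  have eq: "(cmod (u z - a - b * z))\<^sup>2 = (cmod (u z))\<^sup>2
      + Re (2 * cnj a * b * z - 2 * cnj a * u z + (- 2 * cnj b) * (cnj z * u z))
      + ((cmod a)\<^sup>2 + (cmod b)\<^sup>2)" if "cmod z = 1" for z
  proof -
    have z: "Re z * Re z + Im z * Im z = 1"
      using that by (metis cmod_power2 power2_eq_square one_power2)
    have "(Re b * Re z - Im b * Im z)\<^sup>2 + (Re b * Im z + Im b * Re z)\<^sup>2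
        = ((Re b)\<^sup>2 + (Im b)\<^sup>2) * (Re z * Re z + Im z * Im z)"
      by (simp add: power2_eq_square algebra_simps)
    then show ?thesis
      unfolding cmod_power2 z by (simp add: power2_eq_square algebra_simps)
  qed
  have "circle_average (\<lambda>z. (cmod (u z - a - b * z))\<^sup>2) = circle_average (\<lambda>z. (cmod (u z))\<^sup>2
      + Re (2 * cnj a * b * z - 2 * cnj a * u z + (- 2 * cnj b) * (cnj z * u z))
      + ((cmod a)\<^sup>2 + (cmod b)\<^sup>2))"
    by (rule circle_average_cong) (rule eq)
  also have "\<dots> = circle_average (\<lambda>z. (cmod (u z))\<^sup>2)
      + Re (circle_average (\<lambda>z. 2 * cnj a * b * z - 2 * cnj a * u z + (- 2 * cnj b) * (cnj z * u z)))
      + ((cmod a)\<^sup>2 + (cmod b)\<^sup>2)"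
  proof -
    let ?v = "\<lambda>z. 2 * cnj a * b * z - 2 * cnj a * u z + (- 2 * cnj b) * (cnj z * u z)"
    have "circle_average (\<lambda>z. (cmod (u z))\<^sup>2 + Re (?v z) + ((cmod a)\<^sup>2 + (cmod b)\<^sup>2))
        = circle_average (\<lambda>z. (cmod (u z))\<^sup>2 + Re (?v z)) + circle_average (\<lambda>_. (cmod a)\<^sup>2 + (cmod b)\<^sup>2)"
      by (rule circle_average_add) (intro continuous_intros)+
    also have "circle_average (\<lambda>z. (cmod (u z))\<^sup>2 + Re (?v z))
        = circle_average (\<lambda>z. (cmod (u z))\<^sup>2) + circle_average (\<lambda>z. Re (?v z))"
      by (rule circle_average_add) (intro continuous_intros)+
    also have "circle_average (\<lambda>z. Re (?v z)) = Re (circle_average ?v)"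
      by (rule circle_average_Re) (intro continuous_intros)
    finally show ?thesis by simp
  qed
  also have "circle_average (\<lambda>z. 2 * cnj a * b * z - 2 * cnj a * u z + (- 2 * cnj b) * (cnj z * u z))
     = - 2 * cnj a * u 0 - 2 * cnj b * deriv u 0"
  proof -
    have "circle_average (\<lambda>z. 2 * cnj a * b * z - 2 * cnj a * u z + (- 2 * cnj b) * (cnj z * u z))
      = circle_average (\<lambda>z. 2 * cnj a * b * z - 2 * cnj a * u z)
        + circle_average (\<lambda>z. (- 2 * cnj b) * (cnj z * u z))"
      by (rule circle_average_add) (intro continuous_intros)+
    also have "circle_average (\<lambda>z. 2 * cnj a * b * z - 2 * cnj a * u z) = - 2 * cnj a * u 0"
      by (subst circle_average_holomorphic) (auto intro!: holomorphic_intros u)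
    also have "circle_average (\<lambda>z. (- 2 * cnj b) * (cnj z * u z)) = (- 2 * cnj b) * deriv u 0"
      by (rule trans[OF circle_average_mult_left]) (simp only: circle_average_cnj_mult[OF u])
    finally show ?thesis by simp
  qed
  also have "circle_average (\<lambda>z. (cmod (u z))\<^sup>2) + Re (- 2 * cnj a * u 0 - 2 * cnj b * deriv u 0)
      + ((cmod a)\<^sup>2 + (cmod b)\<^sup>2) = circle_average (\<lambda>z. (cmod (u z))\<^sup>2)
         - (cmod (u 0))\<^sup>2 - (cmod (deriv u 0))\<^sup>2
         + (cmod (u 0 - a))\<^sup>2 + (cmod (deriv u 0 - b))\<^sup>2"
    unfolding cmod_power2 by (simp add: power2_eq_square algebra_simps)
  finally show ?thesis .
qed

lemma Bessel_two_coefficients: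
  assumes u: "u holomorphic_on cball 0 1"
  shows "(cmod (u 0))\<^sup>2 + (cmod (deriv u 0))\<^sup>2 \<le> circle_average (\<lambda>z. (cmod (u z))\<^sup>2)"
proof -
  note cu [continuous_intros] = continuous_on_circle[OF u]
  have "0 \<le> circle_average (\<lambda>z. (cmod (u z - u 0 - deriv u 0 * z))\<^sup>2)"
    by (intro circle_average_nonneg continuous_intros) auto
  then show ?thesis by (subst (asm) average_square_minus_Taylor[OF u]) auto
qed

lemma average_square_minus_const:
  assumes u: "u holomorphic_on cball 0 1"
  shows "circle_average (\<lambda>z. (cmod (u z - u 0))\<^sup>2)
       = circle_average (\<lambda>z. (cmod (u z))\<^sup>2) - (cmod (u 0))\<^sup>2"
  using average_square_minus_Taylor[OF u, of "u 0" 0] by simp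

lemma average_square_affine: "circle_average (\<lambda>z. (cmod (1 + b * z))\<^sup>2) = 1 + (cmod b)\<^sup>2"
proof -
  have "(\<lambda>z. 1 + b * z) holomorphic_on cball 0 1" by (intro holomorphic_intros)
  moreover have "deriv (\<lambda>z. 1 + b * z) 0 = b"
    by (rule DERIV_imp_deriv) (rule derivative_eq_intros refl | simp)+
  ultimately show ?thesis
    using average_square_minus_Taylor[of "\<lambda>z. 1 + b * z" 1 b] by simp
qed

lemma holomorphic_at_0:
  assumes "u holomorphic_on cball 0 1"
  shows "(u has_field_derivative deriv u 0) (at 0)"
  by (rule holomorphic_derivI[OF holomorphic_on_subset[OF assms ball_subset_cball]]) auto

text \<open>
  The second part is the Schwarz-Pick inequality at 0. It follows from Bessel's inequality for
  \<open>B z * (1 + c z)\<close>, whose mean square is \<open>1 + |c|\<^sup>2\<close>, with the best choice of \<open>c\<close>.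
\<close>

lemma inner_deriv_bound:
  assumes B: "B holomorphic_on cball 0 1" and B1: "\<And>z. cmod z = 1 \<Longrightarrow> cmod (B z) = 1"
  shows "cmod (B 0) \<le> 1" "cmod (deriv B 0) \<le> 1 - (cmod (B 0))\<^sup>2"
proof -
  have "circle_average (\<lambda>z. (cmod (B z))\<^sup>2) = circle_average (\<lambda>z. 1::real)"
    by (rule circle_average_cong) (simp add: B1)
  then have le: "(cmod (B 0))\<^sup>2 + (cmod (deriv B 0))\<^sup>2 \<le> 1"
    using Bessel_two_coefficients[OF B] by simp
  then show b0: "cmod (B 0) \<le> 1"
    using power2_le_imp_le[of "cmod (B 0)" 1] zero_le_power2[of "cmod (deriv B 0)"] by (simp del: zero_le_power2)
  note DB = holomorphic_at_0[OF B]
  have gen: "(cmod (B 0))\<^sup>2 + (cmod (deriv B 0 + c * B 0))\<^sup>2 \<le> 1 + (cmod c)\<^sup>2" for c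
  proof -
    have hol: "(\<lambda>z. B z * (1 + c * z)) holomorphic_on cball 0 1"
      by (intro holomorphic_intros B)
    have d: "deriv (\<lambda>z. B z * (1 + c * z)) 0 = deriv B 0 + c * B 0"
      by (rule DERIV_imp_deriv) (rule DB derivative_eq_intros refl | simp)+
    have "circle_average (\<lambda>z. (cmod (B z * (1 + c * z)))\<^sup>2) = circle_average (\<lambda>z. (cmod (1 + c * z))\<^sup>2)"
      by (rule circle_average_cong) (simp add: B1 norm_mult)
    also have "\<dots> = 1 + (cmod c)\<^sup>2"
      by (rule average_square_affine)
    finally show ?thesis using Bessel_two_coefficients[OF hol] d by simp
  qed
  define x where "x = cmod (deriv B 0)"
  define y where "y = cmod (B 0)"
  show "cmod (deriv B 0) \<le> 1 - (cmod (B 0))\<^sup>2"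
  proof (cases "x = 0 \<or> y = 0")
    case True
    then show ?thesis using le b0 unfolding x_def y_def
      using power2_le_imp_le[of "cmod (deriv B 0)" 1] by (auto simp: power_le_one)
  next
    case False
    then have pos: "x > 0" "y > 0" by (auto simp: x_def y_def)
    have q: "y\<^sup>2 + (x + k * y)\<^sup>2 \<le> 1 + k\<^sup>2" if "k \<ge> 0" for k :: real
    proof -
      \<comment> \<open>This \<open>c\<close> has modulus \<open>k\<close>, and \<open>c * B 0\<close> points in the direction of \<open>deriv B 0\<close>.\<close>
      define c where "c = of_real k * (sgn (deriv B 0) / sgn (B 0))"
      have "c * B 0 = sgn (deriv B 0) * of_real (k * y)"
        using False by (auto simp: c_def sgn_div_norm y_def scaleR_conv_of_real field_simps)
      then have "deriv B 0 + c * B 0 = sgn (deriv B 0) * of_real (x + k * y)"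
        using False by (auto simp: x_def algebra_simps sgn_div_norm scaleR_conv_of_real)
      then have "cmod (deriv B 0 + c * B 0) = x + k * y"
        using False that pos by (simp del: of_real_add of_real_mult add: norm_mult norm_sgn x_def)
      moreover have "cmod c = k"
        using False that by (auto simp: c_def norm_mult norm_divide norm_sgn x_def y_def)
      ultimately show ?thesis using gen[of c] by (simp add: y_def)
    qed
    have "y\<^sup>2 < 1" using le pos unfolding x_def[symmetric] y_def[symmetric]
      using zero_less_power[of x 2] by linarith
    define d where "d = 1 - y\<^sup>2"
    have d: "d > 0" "y\<^sup>2 = 1 - d" using \<open>y\<^sup>2 < 1\<close> by (auto simp: d_def)
    \<comment> \<open>The inequality \<open>q\<close> is sharpest for \<open>k = x * y / d\<close>.\<close>
    have "y\<^sup>2 + (x + (x*y/d) * y)\<^sup>2 \<le> 1 + (x*y/d)\<^sup>2"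
      using q[of "x*y/d"] pos d by simp
    moreover have "x + (x*y/d) * y = x * (d + y\<^sup>2) / d"
      using d(1) by (simp add: field_simps power2_eq_square)
    then have "x + (x*y/d) * y = x / d" using d(2) by simp
    moreover have "(x*y/d)\<^sup>2 = x\<^sup>2 * (1 - d) / d\<^sup>2"
      using d by (simp add: power_mult_distrib power_divide)
    ultimately have "1 - d + x\<^sup>2/d\<^sup>2 \<le> 1 + x\<^sup>2 * (1 - d) / d\<^sup>2"
      using d by (simp add: power_divide)
    also have "x\<^sup>2 * (1 - d) / d\<^sup>2 = x\<^sup>2 / d\<^sup>2 - x\<^sup>2 / d"
      using d by (simp add: field_simps power2_eq_square)
    finally have "x\<^sup>2 / d \<le> d" by simp
    then have "x\<^sup>2 \<le> d\<^sup>2" using d by (simp add: pos_divide_le_eq power2_eq_square)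
    then show ?thesis using d power2_le_imp_le[of x d] by (simp add: x_def d_def y_def)
  qed
qed

section \<open>Inner functions and the removal of zeros\<close>

text \<open>
  For quotients by a power of \<open>z - a\<close>: away from \<open>a\<close> they are holomorphic by division, and near \<open>a\<close>
  they agree with the cofactor of a local factorization.
\<close>

lemma holomorphic_on_cball_replace:
  assumes k: "k holomorphic_on cball 0 1 - {a}" and h: "h holomorphic_on ball a r"
    and a: "cmod a < 1" "0 < r" and eq: "\<And>z. z \<in> ball a r \<Longrightarrow> k z = h z"
  shows "k holomorphic_on cball 0 1"
proof (rule holomorphic_onI)
  fix x :: complex assume x: "x \<in> cball 0 1"
  show "k field_differentiable at x within cball 0 1"
  proof (cases "x = a")
    case True
    have "k holomorphic_on ball a r"
      using h by (rule holomorphic_transform) (simp add: eq)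
    then show ?thesis
      using True a by (meson centre_in_ball field_differentiable_at_within holomorphic_on_imp_differentiable_at open_ball)
  next
    case False
    have "at x within cball 0 1 = at x within (cball 0 1 - {a})"
      using at_within_nhd[of x "- {a}" "cball 0 1" "cball 0 1 - {a}"] False by auto
    then show ?thesis using k x False unfolding holomorphic_on_def by auto
  qed
qed

lemma factor_out_zero:
  assumes f: "f holomorphic_on cball 0 1" and a: "cmod a < 1" "f a = 0"
    and nz: "\<not> f constant_on ball 0 1"
  obtains k n where "0 < n" "k holomorphic_on cball 0 1" "k a \<noteq> 0"
    "\<And>z. z \<in> cball 0 1 \<Longrightarrow> f z = (z - a) ^ n * k z"
proof -
  have fb: "f holomorphic_on ball 0 1" by (rule holomorphic_on_subset[OF f ball_subset_cball])
  have "a \<in> ball 0 1" using a by simp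
  then obtain h r n where h: "0 < n" "0 < r" "ball a r \<subseteq> ball 0 1" "h holomorphic_on ball a r"
    "\<And>w. w \<in> ball a r \<Longrightarrow> f w = (w - a) ^ n * h w" "\<And>w. w \<in> ball a r \<Longrightarrow> h w \<noteq> 0"
    by (rule holomorphic_factor_zero_nonconstant[OF fb open_ball connected_ball _ a(2) nz]) blast
  define k where "k = (\<lambda>z. if z = a then h a else f z / (z - a) ^ n)"
  have kh: "k z = h z" if "z \<in> ball a r" for z
    using h(5)[OF that] by (auto simp: k_def)
  have "(\<lambda>z. f z / (z - a) ^ n) holomorphic_on cball 0 1 - {a}"
    by (intro holomorphic_intros holomorphic_on_subset[OF f]) auto
  then have "k holomorphic_on cball 0 1 - {a}"
    by (rule holomorphic_transform) (simp add: k_def)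
  then have "k holomorphic_on cball 0 1"
    using holomorphic_on_cball_replace[OF _ h(4) a(1) h(2) kh] by blast
  moreover have "k a \<noteq> 0" using h(2,6) by (simp add: k_def)
  moreover have "f z = (z - a) ^ n * k z" for z
    using a h(1) by (simp add: k_def)
  ultimately show thesis using that h(1) by blast
qed

lemma cmod_Moebius_on_circle:
  assumes "cmod z = 1" "cmod a < 1"
  shows "cmod ((z - a) / (1 - cnj a * z)) = 1"
proof -
  have "cmod (z - a) = cmod (cnj (z - a) * z)"
    using assms(1) by (simp only: norm_mult complex_mod_cnj)
  also have "cnj (z - a) * z = 1 - cnj a * z"
    using complex_norm_square[of z] assms(1) by (simp add: algebra_simps)
  finally have "cmod (z - a) = cmod (1 - cnj a * z)" .
  moreover have "cmod (z - a) \<noteq> 0" using assms by auto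
  ultimately show ?thesis unfolding norm_divide by (metis divide_self)
qed

text \<open>
  Induction on the number of distinct zeros: dividing \<open>f\<close> by a power of the Moebius factor of one zero
  removes that zero, keeps the other ones, and leaves \<open>|f|\<close> unchanged on the circle.
\<close>

lemma Blaschke_factorization:
  assumes f: "f holomorphic_on cball 0 1" and nz: "\<And>z. cmod z = 1 \<Longrightarrow> f z \<noteq> 0"
    and fin: "finite {z \<in> ball 0 1. f z = 0}"
  obtains B G where "B holomorphic_on cball 0 1" "G holomorphic_on cball 0 1"
    "\<And>z. cmod z = 1 \<Longrightarrow> cmod (B z) = 1" "\<And>z. z \<in> cball 0 1 \<Longrightarrow> G z \<noteq> 0"
    "\<And>z. z \<in> cball 0 1 \<Longrightarrow> f z = B z * G z"
proof -
  have "\<exists>B G. B holomorphic_on cball 0 1 \<and> G holomorphic_on cball 0 1 \<and>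
    (\<forall>z. cmod z = 1 \<longrightarrow> cmod (B z) = 1) \<and> (\<forall>z \<in> cball 0 1. G z \<noteq> 0) \<and>
    (\<forall>z \<in> cball 0 1. f z = B z * G z)"
    using f nz fin
  proof (induction "card {z \<in> ball 0 1. f z = 0}" arbitrary: f)
    case 0
    then have "\<forall>z\<in>ball 0 1. f z \<noteq> 0" by auto
    with 0 show ?case by (intro exI[of _ "\<lambda>_. 1"] exI[of _ f]) (auto simp: less_eq_real_def)
  next
    case (Suc m)
    let ?Z = "\<lambda>f :: complex \<Rightarrow> complex. {z \<in> ball 0 1. f z = 0}"
    have "?Z f \<noteq> {}" using Suc.hyps(2) by (metis card.empty nat.simps(3))
    then obtain a where a: "cmod a < 1" "f a = 0" by auto
    have "\<not> f constant_on ball 0 1"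
    proof
      assume "f constant_on ball 0 1"
      then obtain c where "\<And>z. z \<in> ball 0 1 \<Longrightarrow> f z = c"
        unfolding constant_on_def by blast
      from this this[of a] have "?Z f = ball 0 1" using a by auto
      moreover have "infinite (ball 0 1 :: complex set)"
        using open_ball finite_imp_not_open[of "ball 0 1 :: complex set"] by auto
      ultimately show False using Suc.prems(3) by simp
    qed
    then obtain k n where k: "0 < n" "k holomorphic_on cball 0 1" "k a \<noteq> 0"
      "\<And>z. z \<in> cball 0 1 \<Longrightarrow> f z = (z - a) ^ n * k z"
      by (rule factor_out_zero[OF Suc.prems(1) a]) blast
    have ne: "1 - cnj a * z \<noteq> 0" if "cmod z \<le> 1" for z
    proof
      assume "1 - cnj a * z = 0"
      then have "cmod (cnj a * z) = 1" by (metis eq_iff_diff_eq_0 norm_one)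
      moreover have "cmod (cnj a * z) \<le> cmod a * 1"
        unfolding norm_mult using that by (intro mult_mono) auto
      ultimately show False using a by simp
    qed
    define M where "M = (\<lambda>z. (z - a) / (1 - cnj a * z))"
    define f1 where "f1 = (\<lambda>z. (1 - cnj a * z) ^ n * k z)"
    have f1: "f z = M z ^ n * f1 z" if "z \<in> cball 0 1" for z
      using k(4)[OF that] ne[of z] that by (simp add: M_def f1_def power_divide)
    have M: "M holomorphic_on cball 0 1"
      unfolding M_def using ne by (intro holomorphic_intros) auto
    have Z: "?Z f1 = ?Z f - {a}"
    proof -
      have "f1 z = 0 \<longleftrightarrow> f z = 0 \<and> z \<noteq> a" if "z \<in> ball 0 1" for z
        using k(4)[of z] k(3) ne[of z] that by (auto simp: f1_def)
      then show ?thesis by auto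
    qed
    have "card (?Z f1) = m"
      unfolding Z using Suc.hyps(2) Suc.prems(3) a by (subst card_Diff_singleton) auto
    moreover have "f1 holomorphic_on cball 0 1"
      unfolding f1_def by (intro holomorphic_intros k)
    moreover have "f1 z \<noteq> 0" if "cmod z = 1" for z
      using f1[of z] Suc.prems(2)[OF that] that by auto
    moreover have "finite (?Z f1)" unfolding Z using Suc.prems(3) by simp
    ultimately obtain B G where BG: "B holomorphic_on cball 0 1" "G holomorphic_on cball 0 1"
      "\<forall>z. cmod z = 1 \<longrightarrow> cmod (B z) = 1" "\<forall>z \<in> cball 0 1. G z \<noteq> 0"
      "\<forall>z \<in> cball 0 1. f1 z = B z * G z"
      using Suc.hyps(1)[of f1] by auto
    show ?case
    proof (intro exI conjI)
      show "(\<lambda>z. M z ^ n * B z) holomorphic_on cball 0 1"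
        by (intro holomorphic_intros M BG)
      show "\<forall>z. cmod z = 1 \<longrightarrow> cmod (M z ^ n * B z) = 1"
        using BG(3) cmod_Moebius_on_circle[OF _ a(1)] by (simp add: M_def norm_mult norm_power)
    qed (use BG f1 in auto)
  qed
  then show thesis using that by blast
qed

text \<open>
  The closed disc is contractible, so the zero-free factor has a logarithm. Working with \<open>L\<close> rather
  than with \<open>exp (L z)\<close> gives holomorphic powers of every real exponent.
\<close>

lemma inner_times_exp_factorization:
  assumes "f holomorphic_on cball 0 1" "\<And>z. cmod z = 1 \<Longrightarrow> f z \<noteq> 0"
    "finite {z \<in> ball 0 1. f z = 0}"
  obtains B L where "B holomorphic_on cball 0 1" "L holomorphic_on cball 0 1"
    "\<And>z. cmod z = 1 \<Longrightarrow> cmod (B z) = 1"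
    "\<And>z. z \<in> cball 0 1 \<Longrightarrow> f z = B z * exp (L z)"
proof -
  obtain B G where BG: "B holomorphic_on cball 0 1" "G holomorphic_on cball 0 1"
    "\<And>z. cmod z = 1 \<Longrightarrow> cmod (B z) = 1" "\<And>z. z \<in> cball 0 1 \<Longrightarrow> G z \<noteq> 0"
    "\<And>z. z \<in> cball 0 1 \<Longrightarrow> f z = B z * G z"
    by (rule Blaschke_factorization[OF assms], assumption, rule that)
  obtain L where "L holomorphic_on cball 0 1" "\<And>z. z \<in> cball 0 1 \<Longrightarrow> G z = exp (L z)"
    using contractible_imp_holomorphic_log[OF BG(2) convex_imp_contractible[OF convex_cball] BG(4)] by metis
  then show thesis using that[of B L] BG by auto
qed

section \<open>Means over smaller circles\<close>

lemma integral_circle_shift: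
  assumes "continuous_on (sphere 0 1) (u :: complex \<Rightarrow> real)" and a: "0 \<le> a" "a \<le> 2*pi"
  shows "integral {0..2*pi} (\<lambda>t. u (cis (a + t))) = integral {0..2*pi} (\<lambda>t. u (cis t))"
proof -
  let ?U = "\<lambda>t. u (cis t)"
  note I = integrable_on_circle[OF assms(1)]
  have "integral {0..2*pi} (\<lambda>t. u (cis (a + t))) = integral {0+a..2*pi+a} ?U"
    using integral_shift_Icc_real[of 0 "2*pi" ?U a] by (simp add: o_def)
  also have "\<dots> = integral {a..2*pi} ?U + integral {2*pi..2*pi+a} ?U"
    using Henstock_Kurzweil_Integration.integral_combine[of a "2*pi" "2*pi+a" ?U] a I by simp
  also have "integral {2*pi..2*pi+a} ?U = integral {0+2*pi..a+2*pi} ?U"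
    by (simp add: add.commute)
  also have "\<dots> = integral {0..a} (?U \<circ> (+) (2*pi))"
    by (rule integral_shift_Icc_real[symmetric])
  also have "?U \<circ> (+) (2*pi) = ?U"
    by (simp add: o_def fun_eq_iff cis_mult[symmetric])
  also have "integral {a..2*pi} ?U + integral {0..a} ?U = integral {0..2*pi} ?U"
    using Henstock_Kurzweil_Integration.integral_combine[of 0 a "2*pi" ?U] a I by simp
  finally show ?thesis .
qed

lemma circle_average_rotate:
  assumes "continuous_on (sphere 0 1) (u :: complex \<Rightarrow> real)" and c: "cmod c = 1"
  shows "circle_average (\<lambda>z. u (c * z)) = circle_average u"
proof -
  define a where "a = Arg2pi c"
  have "c = cis a" using c Arg2pi_eq[of c] by (simp add: a_def cis_conv_exp)
  moreover have "0 \<le> a" "a \<le> 2*pi" using Arg2pi[of c] by (auto simp: a_def)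
  ultimately show ?thesis
    using integral_circle_shift[OF assms(1), of a]
    by (simp add: circle_average_def cis_mult)
qed

text \<open>
  Let \<open>I\<close> and \<open>J\<close> be the integrals of \<open>|g|\<^sup>2\<close> over the circles of radius 1 and \<open>r\<close>. The function
  \<open>F z\<close>, the integral of \<open>g (z * cis t) * cnj (g (r * cis t))\<close> over \<open>t\<close>, is holomorphic in the disc, has
  the value \<open>J\<close> at \<open>r\<close>, and is bounded by \<open>(I + J) / 2\<close> for \<open>|z| = 1\<close>. The maximum principle yields
  \<open>J \<le> (I + J) / 2\<close>.
\<close>

lemma average_square_dilation_le:
  assumes g: "g holomorphic_on cball 0 1" and r: "0 \<le> r" "r \<le> 1"
  shows "circle_average (\<lambda>z. (cmod (g (of_real r * z)))\<^sup>2) \<le> circle_average (\<lambda>z. (cmod (g z))\<^sup>2)"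
proof -
  have cg: "continuous_on (cball 0 1) g" by (rule holomorphic_on_imp_continuous_on[OF g])
  have gb: "g holomorphic_on ball 0 1" by (rule holomorphic_on_subset[OF g ball_subset_cball])
  define h where "h = (\<lambda>t. cnj (g (of_real r * cis t)))"
  define F where "F = (\<lambda>z. integral (cbox 0 (2*pi)) (\<lambda>t. g (z * cis t) * h t))"
  have ch [continuous_intros]: "continuous_on A h" for A
    unfolding h_def using r
    by (intro continuous_intros continuous_on_compose2[OF cg]) (auto simp: norm_mult)
  have cgt [continuous_intros]: "continuous_on (cball 0 1 \<times> A) (\<lambda>(z, t). g (z * cis t) * h t)" for A
    unfolding split_beta
    by (intro continuous_intros continuous_on_compose2[OF cg] continuous_on_compose2[OF ch])
       (auto simp: norm_mult)
  have contF: "continuous_on (cball 0 1) F"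
    unfolding F_def by (rule integral_continuous_on_param[OF cgt])
  have slice: "(\<lambda>t. g (z * cis t) * h t) integrable_on cbox 0 (2*pi)" if "cmod z \<le> 1" for z
    by (rule integrable_continuous, intro continuous_intros continuous_on_compose2[OF cg])
       (use that in \<open>auto simp: norm_mult\<close>)
  have cdg: "continuous_on (ball 0 1) (deriv g)"
    by (intro holomorphic_on_imp_continuous_on holomorphic_deriv gb) auto
  have holF: "F holomorphic_on ball 0 1"
    unfolding F_def
  proof (rule leibniz_rule_holomorphic[where fx = "\<lambda>z t. deriv g (z * cis t) * cis t * h t"])
    fix z :: complex and t :: real assume z: "z \<in> ball 0 1"
    have "(g has_field_derivative deriv g (z * cis t)) (at (z * cis t))"
      by (rule holomorphic_derivI[OF gb]) (use z in \<open>auto simp: norm_mult\<close>)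
    then have "((\<lambda>z. g (z * cis t)) has_field_derivative deriv g (z * cis t) * cis t) (at z)"
      by (rule DERIV_chain2) (auto intro!: derivative_eq_intros)
    then show "((\<lambda>z. g (z * cis t) * h t) has_field_derivative deriv g (z * cis t) * cis t * h t)
        (at z within ball 0 1)"
      by (intro DERIV_cmult_right) (rule has_field_derivative_at_within)
  next
    show "continuous_on (ball 0 1 \<times> cbox 0 (2*pi)) (\<lambda>(z, t). deriv g (z * cis t) * cis t * h t)"
      unfolding split_beta
      by (intro continuous_intros continuous_on_compose2[OF cdg] continuous_on_compose2[OF ch])
         (auto simp: norm_mult)
  qed (use slice in auto)
  define I where "I = integral {0..2*pi} (\<lambda>t. (cmod (g (cis t)))\<^sup>2)"
  define J where "J = integral {0..2*pi} (\<lambda>t. (cmod (g (of_real r * cis t)))\<^sup>2)"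
  have intI: "(\<lambda>t. (cmod (g (c * cis t)))\<^sup>2) integrable_on {0..2*pi}" if "cmod c \<le> 1" for c
    by (rule integrable_continuous_real)
       (intro continuous_intros continuous_on_compose2[OF cg], use that in \<open>auto simp: norm_mult\<close>)
  have bd: "cmod (F z) \<le> (I + J) / 2" if z: "z \<in> frontier (cball 0 1)" for z
  proof -
    have z1: "cmod z = 1" using z by simp
    have "cmod (F z) \<le> integral {0..2*pi} (\<lambda>t. ((cmod (g (z * cis t)))\<^sup>2 + (cmod (g (of_real r * cis t)))\<^sup>2) / 2)"
      unfolding F_def cbox_interval
    proof (rule integral_norm_bound_integral)
      show "(\<lambda>t. ((cmod (g (z * cis t)))\<^sup>2 + (cmod (g (of_real r * cis t)))\<^sup>2) / 2) integrable_on {0..2*pi}"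
        using integrable_add[OF intI[of z] intI[of "of_real r"]] z1 r by simp
      show "cmod (g (z * cis t) * h t) \<le> ((cmod (g (z * cis t)))\<^sup>2 + (cmod (g (of_real r * cis t)))\<^sup>2) / 2" for t
        using sum_squares_bound[of "cmod (g (z * cis t))" "cmod (g (of_real r * cis t))"]
        by (simp add: norm_mult h_def)
    qed (use slice[of z] z1 in auto)
    also have "\<dots> = (integral {0..2*pi} (\<lambda>t. (cmod (g (z * cis t)))\<^sup>2) + J) / 2"
      using integral_add[OF intI[of z] intI[of "of_real r"]] z1 r by (simp add: J_def)
    also have "integral {0..2*pi} (\<lambda>t. (cmod (g (z * cis t)))\<^sup>2) = I"
    proof -
      have "continuous_on (sphere 0 1) (\<lambda>z. (cmod (g z))\<^sup>2)"
        by (intro continuous_intros continuous_on_circle[OF g])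
      from circle_average_rotate[OF this z1] show ?thesis
        by (simp add: circle_average_def I_def)
    qed
    finally show ?thesis .
  qed
  have "cmod (F (of_real r)) \<le> (I + J) / 2"
    by (rule maximum_modulus_frontier[of F "cball 0 1"]) (use holF contF bd r in auto)
  moreover have "F (of_real r) = of_real J"
  proof -
    have "F (of_real r) = integral {0..2*pi} (\<lambda>t. of_real ((cmod (g (of_real r * cis t)))\<^sup>2))"
      unfolding F_def h_def cbox_interval by (rule integral_cong) (simp only: complex_norm_square)
    also have "\<dots> = of_real J"
      unfolding J_def using integral_linear[OF intI[of "of_real r"] bounded_linear_of_real] r
      by (simp add: o_def)
    finally show ?thesis .
  qed
  ultimately have "\<bar>J\<bar> \<le> (I + J) / 2" by simp
  then have "J \<le> I" using abs_ge_self[of J] by (simp add: field_simps)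
  then show ?thesis by (simp add: circle_average_def I_def J_def divide_right_mono)
qed

lemma inner_le_1:
  assumes B: "B holomorphic_on cball 0 1" "\<And>z. cmod z = 1 \<Longrightarrow> cmod (B z) = 1" and z: "cmod z \<le> 1"
  shows "cmod (B z) \<le> 1"
  by (rule maximum_modulus_frontier[of B "cball 0 1"])
     (use assms holomorphic_on_imp_continuous_on[OF B(1)] holomorphic_on_subset[OF B(1) ball_subset_cball] in auto)

lemma cmod_exp_powr: "cmod (exp w) powr p = exp (p * Re w)"
  by (simp add: powr_def)

text \<open>
  Replacing \<open>f = B * exp L\<close> by \<open>exp L\<close> does not decrease the mean over the smaller circle, where \<open>|B| \<le> 1\<close>, and
  keeps the mean over the unit circle. The \<open>p\<close>-th power of \<open>|exp L|\<close> is the square of \<open>|exp (p L / 2)|\<close>.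
\<close>

lemma average_powr_dilation_le:
  assumes f: "f holomorphic_on cball 0 1" "\<And>z. cmod z = 1 \<Longrightarrow> f z \<noteq> 0"
    "finite {z \<in> ball 0 1. f z = 0}" and p: "0 < p" and r: "0 \<le> r" "r \<le> 1"
  shows "circle_average (\<lambda>z. cmod (f (of_real r * z)) powr p) \<le> circle_average (\<lambda>z. cmod (f z) powr p)"
proof -
  obtain B L where BL: "B holomorphic_on cball 0 1" "L holomorphic_on cball 0 1"
    "\<And>z. cmod z = 1 \<Longrightarrow> cmod (B z) = 1" "\<And>z. z \<in> cball 0 1 \<Longrightarrow> f z = B z * exp (L z)"
    by (rule inner_times_exp_factorization[OF f], assumption, rule that)
  define g where "g = (\<lambda>z. exp (of_real (p/2) * L z))"
  have g: "g holomorphic_on cball 0 1" unfolding g_def by (intro holomorphic_intros BL)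
  have rz: "of_real r * z \<in> cball 0 1" if "cmod z = 1" for z :: complex
    using that r by (simp add: norm_mult)
  have g2: "(cmod (g z))\<^sup>2 = cmod (exp (L z)) powr p" for z
    unfolding g_def cmod_exp_powr by (simp add: exp_double[symmetric])
  have cf: "continuous_on (cball 0 1) f" "continuous_on (cball 0 1) g"
    using holomorphic_on_imp_continuous_on f g by blast+
  have "circle_average (\<lambda>z. cmod (f (of_real r * z)) powr p) \<le> circle_average (\<lambda>z. (cmod (g (of_real r * z)))\<^sup>2)"
  proof (rule circle_average_mono)
    show "continuous_on (sphere 0 1) (\<lambda>z. cmod (f (of_real r * z)) powr p)"
      by (intro continuous_intros continuous_on_compose2[OF cf(1)] continuous_on_powr') (use rz p in auto)
    show "continuous_on (sphere 0 1) (\<lambda>z. (cmod (g (of_real r * z)))\<^sup>2)"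
      by (intro continuous_intros continuous_on_compose2[OF cf(2)]) (use rz in auto)
    show "cmod (f (of_real r * z)) powr p \<le> (cmod (g (of_real r * z)))\<^sup>2" if "cmod z = 1" for z
      unfolding g2 using BL(4)[OF rz[OF that]] inner_le_1[OF BL(1,3), of "of_real r * z"] rz[OF that] p
      by (auto simp: norm_mult intro!: powr_mono2 mult_left_le_one_le)
  qed
  also have "\<dots> \<le> circle_average (\<lambda>z. (cmod (g z))\<^sup>2)"
    by (rule average_square_dilation_le[OF g r])
  also have "\<dots> = circle_average (\<lambda>z. cmod (f z) powr p)"
    by (rule circle_average_cong) (simp add: g2 BL norm_mult)
  finally show ?thesis .
qed

section \<open>Inequalities for real and complex powers\<close>

text \<open>
  Taylor's formula of second order for \<open>|1 + t w|\<^sup>q\<close> between \<open>t = 0\<close> and \<open>t = 1\<close>. The function is smooth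
  because \<open>1 + t w\<close> does not vanish for nonreal \<open>w\<close>.
\<close>

lemma powr_convexity_nonreal:
  fixes w :: complex and q :: real
  assumes q: "1 < q" "q \<le> 2" and w: "Im w \<noteq> 0"
  shows "1 + q * Re w + q * (q - 1) / 2 * ((cmod w)\<^sup>2 * (1 + cmod w) powr (q - 2)) \<le> cmod (1 + w) powr q"
proof -
  define N where "N = (\<lambda>t. 1 + 2 * t * Re w + t\<^sup>2 * (cmod w)\<^sup>2)"
  define N1 where "N1 = (\<lambda>t. 2 * Re w + 2 * t * (cmod w)\<^sup>2)"
  have N: "N t = (cmod (1 + of_real t * w))\<^sup>2" for t
    unfolding N_def cmod_power2 by (simp add: power2_eq_square algebra_simps)
  have Npos: "N t > 0" for t
  proof -
    have "1 + of_real t * w \<noteq> 0"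
    proof
      assume "1 + of_real t * w = 0"
      then have "Re (1 + of_real t * w) = 0" "Im (1 + of_real t * w) = 0" by simp_all
      then show False using w by simp
    qed
    then show ?thesis unfolding N by simp
  qed
  have dN: "(N has_real_derivative N1 t) (at t)" for t
    unfolding N_def N1_def by (auto intro!: derivative_eq_intros simp: algebra_simps)
  have dN1: "(N1 has_real_derivative 2 * (cmod w)\<^sup>2) (at t)" for t
    unfolding N1_def by (auto intro!: derivative_eq_intros)
  define D where "D = (\<lambda>m::nat. if m = 0 then (\<lambda>t. N t powr (q/2))
     else if m = 1 then (\<lambda>t. q/2 * N t powr (q/2-1) * N1 t)
     else (\<lambda>t. q/2 * ((q/2-1) * N t powr (q/2-2) * (N1 t)\<^sup>2 + N t powr (q/2-1) * (2 * (cmod w)\<^sup>2))))"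
  have d0: "((\<lambda>t. N t powr (q/2)) has_real_derivative q/2 * N t powr (q/2-1) * N1 t) (at t)" for t
  proof -
    have *: "N t powr (q/2) / N t = N t powr (q/2 - 1)"
      using Npos[of t] by (simp add: powr_diff)
    show ?thesis unfolding *[symmetric]
      using DERIV_cong[OF DERIV_powr[OF dN[of t] Npos DERIV_const[of "q/2"]],
          of "q/2 * (N t powr (q/2) / N t) * N1 t"] by simp
  qed
  have d0': "((\<lambda>t. N t powr (q/2-1)) has_real_derivative (q/2-1) * N t powr (q/2-2) * N1 t) (at t)" for t
  proof -
    have *: "N t powr (q/2 - 1) / N t = N t powr (q/2 - 2)"
      using Npos[of t] by (simp add: powr_diff powr_numeral power2_eq_square)
    show ?thesis unfolding *[symmetric]
      using DERIV_cong[OF DERIV_powr[OF dN[of t] Npos DERIV_const[of "q/2-1"]],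
          of "(q/2-1) * (N t powr (q/2-1) / N t) * N1 t"] by simp
  qed
  have d1: "((\<lambda>t. q/2 * N t powr (q/2-1) * N1 t) has_real_derivative
     q/2 * ((q/2-1) * N t powr (q/2-2) * (N1 t)\<^sup>2 + N t powr (q/2-1) * (2 * (cmod w)\<^sup>2))) (at t)" for t
    using DERIV_mult[OF DERIV_cmult[OF d0'[of t], of "q/2"] dN1[of t]]
    by (simp add: power2_eq_square algebra_simps)
  have "\<exists>t>0. t < 1 \<and> (\<lambda>t. N t powr (q/2)) 1 = (\<Sum>m<2. D m 0 / fact m * 1 ^ m) + D 2 t / fact 2 * 1 ^ 2"
  proof (rule Maclaurin)
    show "\<forall>m t. m < 2 \<and> 0 \<le> t \<and> t \<le> 1 \<longrightarrow> ((D m) has_real_derivative D (Suc m) t) (at t)"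
      using d0 d1 by (auto simp: D_def less_Suc_eq numeral_2_eq_2)
  qed (auto simp: D_def)
  then obtain t where t: "0 < t" "t < 1" and eq: "N 1 powr (q/2) = D 0 0 + D 1 0 + D 2 t / 2"
    by (auto simp: numeral_2_eq_2)
  have D0: "D 0 0 = 1" "D 1 0 = q * Re w" by (auto simp: D_def N_def N1_def)
  \<comment> \<open>Cauchy-Schwarz: \<open>N1 t / 2\<close> is the inner product of \<open>w\<close> and \<open>1 + t w\<close>.\<close>
  have CS: "(N1 t)\<^sup>2 \<le> 4 * (cmod w)\<^sup>2 * N t"
  proof -
    have "4 * (cmod w)\<^sup>2 * N t - (N1 t)\<^sup>2 = 4 * ((cmod w)\<^sup>2 - (Re w)\<^sup>2)"
      by (simp add: N_def N1_def power2_eq_square algebra_simps)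
    also have "\<dots> \<ge> 0" by (simp add: cmod_power2)
    finally show ?thesis by simp
  qed
  have "N t powr (q/2-2) * (N1 t)\<^sup>2 \<le> N t powr (q/2-2) * (4 * (cmod w)\<^sup>2 * N t)"
    by (intro mult_left_mono CS) auto
  also have "\<dots> = 4 * (cmod w)\<^sup>2 * N t powr (q/2-1)"
    using Npos[of t] powr_add[of "N t" "q/2-2" 1] by simp
  finally have A: "(1 - q/2) * (N t powr (q/2-2) * (N1 t)\<^sup>2) \<le> (1 - q/2) * (4 * (cmod w)\<^sup>2 * N t powr (q/2-1))"
    using q by (intro mult_left_mono) auto
  have "q * (q - 1) * (cmod w)\<^sup>2 * N t powr (q/2-1)
     = q/2 * (N t powr (q/2-1) * (2 * (cmod w)\<^sup>2) - (1 - q/2) * (4 * (cmod w)\<^sup>2 * N t powr (q/2-1)))"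
    by (simp add: algebra_simps)
  also have "\<dots> \<le> q/2 * (N t powr (q/2-1) * (2 * (cmod w)\<^sup>2) - (1 - q/2) * (N t powr (q/2-2) * (N1 t)\<^sup>2))"
    using A q by (intro mult_left_mono) auto
  also have "\<dots> = D 2 t"
    by (simp add: D_def algebra_simps)
  finally have B: "q * (q - 1) * (cmod w)\<^sup>2 * N t powr (q/2-1) \<le> D 2 t" .
  have "cmod (1 + of_real t * w) \<le> 1 + t * cmod w"
    using norm_triangle_ineq[of 1 "of_real t * w"] t by (simp add: norm_mult)
  also have "\<dots> \<le> 1 + cmod w"
    using t by (simp add: mult_left_le_one_le)
  finally have "N t \<le> (1 + cmod w)\<^sup>2" unfolding N by (rule power_mono) auto
  then have "(1 + cmod w)\<^sup>2 powr (q/2-1) \<le> N t powr (q/2-1)"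
    using q Npos[of t] by (intro powr_mono2') auto
  moreover have "(1 + cmod w)\<^sup>2 powr (q/2-1) = (1 + cmod w) powr (q - 2)"
    using powr_powr[of "1 + cmod w" 2 "q/2-1"] by (simp add: add_nonneg_eq_0_iff algebra_simps powr_numeral)
  ultimately have "q * (q - 1) * (cmod w)\<^sup>2 * (1 + cmod w) powr (q - 2) \<le> q * (q - 1) * (cmod w)\<^sup>2 * N t powr (q/2-1)"
    using q by (intro mult_left_mono) auto
  with B have C: "q * (q - 1) * (cmod w)\<^sup>2 * (1 + cmod w) powr (q - 2) \<le> D 2 t" by linarith
  have "N 1 powr (q/2) = cmod (1 + w) powr q"
    using powr_powr[of "cmod (1 + w)" 2 "q/2"] Npos[of 1] unfolding N
    by (simp add: powr_numeral)
  then show ?thesis using eq C unfolding D0 by simp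
qed

text \<open>
  Real numbers are limits of nonreal ones, which covers the case that \<open>1 + t w\<close> vanishes for some \<open>t\<close>.
\<close>

lemma powr_convexity:
  fixes w :: complex and q :: real
  assumes q: "1 < q" "q \<le> 2"
  shows "1 + q * Re w + q * (q - 1) / 2 * ((cmod w)\<^sup>2 * (1 + cmod w) powr (q - 2)) \<le> cmod (1 + w) powr q"
proof (cases "Im w = 0")
  case False
  then show ?thesis by (rule powr_convexity_nonreal[OF q])
next
  case True
  define v where "v = (\<lambda>e. w + \<i> * complex_of_real e)"
  have v0: "(v \<longlongrightarrow> w) (at_right 0)"
    unfolding v_def by (auto intro!: tendsto_eq_intros)
  have "((\<lambda>e. cmod (1 + v e) powr q) \<longlongrightarrow> cmod (1 + w) powr q) (at_right 0)"
    by (intro tendsto_powr' tendsto_intros v0) (use q in auto)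
  moreover have "((\<lambda>e. 1 + q * Re (v e) + q * (q - 1) / 2 * ((cmod (v e))\<^sup>2 * (1 + cmod (v e)) powr (q - 2)))
     \<longlongrightarrow> 1 + q * Re w + q * (q - 1) / 2 * ((cmod w)\<^sup>2 * (1 + cmod w) powr (q - 2))) (at_right 0)"
    by (intro tendsto_intros v0) (simp add: add_nonneg_eq_0_iff)
  moreover have "eventually (\<lambda>e. 1 + q * Re (v e) + q * (q - 1) / 2 * ((cmod (v e))\<^sup>2 * (1 + cmod (v e)) powr (q - 2))
      \<le> cmod (1 + v e) powr q) (at_right 0)"
    using True by (intro eventually_at_rightI[of 0 1] powr_convexity_nonreal q) (auto simp: v_def)
  ultimately show ?thesis by (intro tendsto_le[of "at_right 0"]) auto
qed

text \<open>
  This replaces Hoelder's inequality: if \<open>l\<^sup>2\<close> is at least the mean square of \<open>x\<close>, then averaging shows that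
  the mean of \<open>x powr p\<close> is at most \<open>2 * l powr p\<close>.
\<close>

lemma powr_le_Young:
  fixes x l p :: real
  assumes "0 \<le> x" "0 < l" "0 < p" "p \<le> 2"
  shows "x powr p \<le> l powr p + l powr (p - 2) * x\<^sup>2"
proof (cases "x \<le> l")
  case True
  then have "x powr p \<le> l powr p" using assms by (intro powr_mono2) auto
  then show ?thesis by (simp add: add_increasing2)
next
  case False
  then have "x > 0" using assms by simp
  have "x powr p = x powr (p - 2) * x\<^sup>2"
    using \<open>x > 0\<close> powr_add[of x "p-2" 2] by (simp add: powr_numeral)
  also have "\<dots> \<le> l powr (p - 2) * x\<^sup>2"
    using False assms by (intro mult_right_mono powr_mono2') auto
  finally show ?thesis by (simp add: add_increasing)
qed

lemma half_powr_le:
  fixes h q :: real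
  assumes "0 < h" "(1 + h) / 2 \<le> h" "1 < q" "q \<le> 2"
  shows "h powr (q - 2) \<le> 2 * (1 + h) powr (q - 2)"
proof -
  have "h powr (q - 2) \<le> ((1 + h) / 2) powr (q - 2)"
    using assms by (intro powr_mono2') auto
  also have "\<dots> = (1 + h) powr (q - 2) * 2 powr (2 - q)"
    using assms by (simp add: powr_divide powr_diff field_simps)
  also have "\<dots> \<le> (1 + h) powr (q - 2) * 2 powr 1"
    using assms by (intro mult_left_mono powr_mono) auto
  finally show ?thesis by (simp add: mult.commute)
qed

text \<open>
  The same principle for the remainder in \<open>powr_convexity\<close>, which behaves like \<open>h\<^sup>2\<close> for small \<open>h\<close> and
  like \<open>h powr (n * p)\<close> for large \<open>h\<close>. The term \<open>h ^ n\<close> arises from an \<open>n\<close>-th power of \<open>1 + W\<close>.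
\<close>

lemma powr_sum_power_le_Young:
  fixes h l p :: real and n :: nat
  assumes h: "0 \<le> h" and l: "0 < l" "l \<le> 1" and p: "0 < p" "p \<le> 2"
    and n: "n \<ge> 1" and q: "1 < n * p" "n * p \<le> 2"
  shows "(h + h ^ n) powr p \<le> 8 * (l powr p + l powr (p - 2) * (h\<^sup>2 * (1 + h) powr (n * p - 2)))"
proof (cases "h \<le> 1")
  case True
  have "h ^ n \<le> h" using n h True power_decreasing[of 1 n h] by simp
  then have "(h + h ^ n) powr p \<le> (2 * h) powr p" using h p by (intro powr_mono2) auto
  also have "\<dots> = 2 powr p * h powr p" using h by (simp add: powr_mult)
  also have "\<dots> \<le> 4 * (l powr p + l powr (p - 2) * h\<^sup>2)"
  proof (rule mult_mono)
    show "2 powr p \<le> (4::real)" using powr_mono[of p 2 "2::real"] p by (simp add: powr_numeral)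
  qed (use powr_le_Young[OF h l(1) p] in auto)
  finally have 1: "(h + h ^ n) powr p \<le> 4 * (l powr p + l powr (p - 2) * h\<^sup>2)" .
  have "2 powr (n*p - 2) \<le> (1 + h) powr (n*p - 2)"
    using h True q by (intro powr_mono2') auto
  moreover have "(2::real) powr (-1) \<le> 2 powr (n*p - 2)" using q by (intro powr_mono) auto
  ultimately have "1 \<le> 2 * (1 + h) powr (n*p - 2)" by (simp add: powr_minus)
  then have "h\<^sup>2 * 1 \<le> h\<^sup>2 * (2 * (1 + h) powr (n*p - 2))" by (intro mult_left_mono) auto
  then have "l powr (p - 2) * h\<^sup>2 \<le> l powr (p - 2) * (h\<^sup>2 * (2 * (1 + h) powr (n*p - 2)))"
    by (intro mult_left_mono) auto
  also have "\<dots> = 2 * (l powr (p - 2) * (h\<^sup>2 * (1 + h) powr (n*p - 2)))" by simp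
  finally show ?thesis using 1 powr_ge_zero[of l p] unfolding distrib_left by linarith
next
  case False
  have "h ^ 1 \<le> h ^ n" using n False by (intro power_increasing) auto
  then have "(h + h ^ n) powr p \<le> (2 * h ^ n) powr p" using h p by (intro powr_mono2) auto
  also have "\<dots> = 2 powr p * h powr (n * p)"
    using h False by (simp add: powr_mult powr_powr flip: powr_realpow)
  also have "\<dots> \<le> 4 * h powr (n * p)"
    using powr_mono[of p 2 "2::real"] p by (intro mult_right_mono) (auto simp: powr_numeral)
  also have "h powr (n * p) = h powr (n * p - 2) * h\<^sup>2"
    using False powr_add[of h "n*p-2" 2] by (simp add: powr_numeral)
  also have "4 * \<dots> \<le> 4 * ((2 * (1 + h) powr (n * p - 2)) * h\<^sup>2)"
    using half_powr_le[of h "n*p"] False q by (intro mult_left_mono mult_right_mono) auto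
  also have "\<dots> = 8 * (1 * (h\<^sup>2 * (1 + h) powr (n * p - 2)))" by simp
  also have "\<dots> \<le> 8 * (l powr (p - 2) * (h\<^sup>2 * (1 + h) powr (n * p - 2)))"
    using powr_mono2'[of "p - 2" l 1] l p by (intro mult_left_mono mult_right_mono) auto
  finally show ?thesis by (simp add: distrib_left add_increasing)
qed

lemma powr_add3_le:
  fixes a b c p :: real
  assumes "0 \<le> a" "0 \<le> b" "0 \<le> c" "0 < p" "p \<le> 2"
  shows "(a + b + c) powr p \<le> 9 * (a powr p + b powr p + c powr p)"
proof -
  define m where "m = max a (max b c)"
  have "(a + b + c) powr p \<le> (3 * m) powr p" using assms by (intro powr_mono2) (auto simp: m_def)
  also have "\<dots> = 3 powr p * m powr p" using assms by (simp add: m_def powr_mult)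
  also have "\<dots> \<le> 9 * (a powr p + b powr p + c powr p)"
  proof (rule mult_mono)
    show "3 powr p \<le> (9::real)" using powr_mono[of p 2 "3::real"] assms by (simp add: powr_numeral)
    show "m powr p \<le> a powr p + b powr p + c powr p"
      by (auto simp: m_def max_def)
  qed auto
  finally show ?thesis .
qed

lemma one_plus_power_le:
  fixes h :: real
  assumes h: "0 \<le> h" and n: "n \<ge> 1"
  shows "(1 + h) ^ n - 1 \<le> 2 ^ n * (h + h ^ n)"
proof (cases "h \<le> 1")
  case True
  have "(1 + h) ^ n \<le> 1 + (2 ^ n - 1) * h" for n
  proof (induction n)
    case (Suc n)
    have "(1 + h) ^ Suc n \<le> (1 + h) * (1 + (2 ^ n - 1) * h)"
      using Suc h by (simp add: mult_left_mono)
    also have "\<dots> = 1 + h + (2 ^ n - 1) * h + (2 ^ n - 1) * (h * h)" by (simp add: algebra_simps)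
    also have "\<dots> \<le> 1 + h + (2 ^ n - 1) * h + (2 ^ n - 1) * (h * 1)"
      using h True by (intro add_left_mono mult_left_mono) auto
    finally show ?case by (simp add: algebra_simps)
  qed auto
  from this[of n] have "(1 + h) ^ n - 1 \<le> 2 ^ n * h" using h by (simp add: algebra_simps)
  also have "\<dots> \<le> 2 ^ n * (h + h ^ n)" using h by (intro mult_left_mono) auto
  finally show ?thesis .
next
  case False
  then have "(1 + h) ^ n \<le> (2 * h) ^ n" by (intro power_mono) auto
  then show ?thesis using h by (simp add: power_mult_distrib algebra_simps add_increasing)
qed

lemma Bernoulli_second_order:
  fixes s z :: real
  assumes s: "1 < s" and z: "0 \<le> z" "z \<le> 1"
  shows "s * (s - 1) / 4 * z\<^sup>2 \<le> (1 + z) powr s - 1 - s * z"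
proof -
  define F where "F = (\<lambda>z. (1 + z) powr s - 1 - s * z - s * (s - 1) / 4 * z\<^sup>2)"
  have "F 0 \<le> F z"
  proof (rule DERIV_nonneg_imp_nondecreasing[of 0 z F])
    fix x assume x: "0 \<le> x" "x \<le> z"
    have d: "(F has_real_derivative s * (1 + x) powr (s - 1) - s - s * (s - 1) / 2 * x) (at x)"
      unfolding F_def using x by (auto intro!: derivative_eq_intros simp: powr_diff field_simps)
    have "(s - 1) * (x / 2) \<le> (s - 1) * (x / (1 + x))"
      using s x z by (intro mult_left_mono divide_left_mono) auto
    also have "x / (1 + x) \<le> ln (1 + x)"
      using ln_le_minus_one[of "1 / (1 + x)"] x by (simp add: ln_div field_simps)
    also have "1 + (s - 1) * ln (1 + x) \<le> (1 + x) powr (s - 1)"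
      using exp_ge_add_one_self[of "(s - 1) * ln (1 + x)"] x by (simp add: powr_def)
    finally have "1 + (s - 1) * (x / 2) \<le> (1 + x) powr (s - 1)"
      using s by (simp add: mult_left_mono)
    then have "s * (1 + (s - 1) * (x / 2)) \<le> s * (1 + x) powr (s - 1)"
      using s by (intro mult_left_mono) auto
    then show "\<exists>y. (F has_real_derivative y) (at x) \<and> 0 \<le> y"
      using d by (intro exI conjI) (auto simp: algebra_simps)
  qed (use z in auto)
  then show ?thesis by (simp add: F_def)
qed

text \<open>
  The quotient \<open>(1 + s z) / (1 + z)\<^sup>s\<close> decreases with \<open>z\<close> and is less than 1 at \<open>z = 1/4\<close>.
\<close>

lemma Bernoulli_strict_uniform:
  fixes s :: real
  assumes s: "1 < s"
  obtains c where "0 < c" "\<And>z. 1/4 \<le> z \<Longrightarrow> c * (1 + z) powr s \<le> (1 + z) powr s - 1 - s * z"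
proof -
  define F where "F = (\<lambda>z. (1 + s * z) * (1 + z) powr (-s))"
  have "F (1/4) < 1"
  proof -
    have "0 < s * (s - 1) / 4 * (1/4)\<^sup>2" using s by simp
    also have "\<dots> \<le> (1 + 1/4) powr s - 1 - s * (1/4)"
      by (rule Bernoulli_second_order[OF s]) auto
    finally have "1 + s * (1/4) < (1 + 1/4) powr s" by simp
    then show ?thesis unfolding F_def powr_minus by (simp add: field_simps)
  qed
  moreover have "F z \<le> F (1/4)" if "1/4 \<le> z" for z
    using that
  proof (rule DERIV_nonpos_imp_nonincreasing[of "1/4" z F])
    fix x :: real assume x: "1/4 \<le> x" "x \<le> z"
    have "(F has_real_derivative s * (1 + x) powr (-s) + (1 + s * x) * (- s * (1 + x) powr (-s - 1))) (at x)"
    proof -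
      have "((\<lambda>x. (1 + x) powr (-s)) has_real_derivative -s * (1 + x) powr (-s - 1)) (at x)"
        using DERIV_fun_powr[of "\<lambda>x. 1 + x" 1 x "-s"] x by (auto intro!: derivative_eq_intros)
      from DERIV_mult[OF DERIV_add[OF DERIV_const DERIV_cmult[OF DERIV_ident]] this, of 1 s]
      show ?thesis by (simp add: F_def mult_ac)
    qed
    moreover have "(1 + x) powr (-s) = (1 + x) * (1 + x) powr (-s - 1)"
      using x powr_add[of "1 + x" 1 "-s-1"] by simp
    then have "s * (1 + x) powr (-s) + (1 + s * x) * (- s * (1 + x) powr (-s - 1))
      = - (s * (s - 1) * x * (1 + x) powr (-s - 1))"
      by (simp add: algebra_simps)
    moreover have "0 \<le> s * (s - 1) * x * (1 + x) powr (-s - 1)"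
      using s x by simp
    ultimately show "\<exists>y. (F has_real_derivative y) (at x) \<and> y \<le> 0" by force
  qed
  ultimately have "(1 - F (1/4)) * (1 + z) powr s \<le> (1 + z) powr s - 1 - s * z" if "1/4 \<le> z" for z
  proof -
    have "(1 + s * z) = F z * (1 + z) powr s"
      using that unfolding F_def powr_minus by simp
    also have "\<dots> \<le> F (1/4) * (1 + z) powr s"
      using \<open>\<And>z. 1/4 \<le> z \<Longrightarrow> F z \<le> F (1/4)\<close>[OF that] by (intro mult_right_mono) auto
    finally show ?thesis by (simp add: algebra_simps)
  qed
  then show thesis using that[of "1 - F (1/4)"] \<open>F (1/4) < 1\<close> by simp
qed

lemma complex_power_Taylor_bound:
  fixes s :: real
  obtains C where "0 \<le> C" "\<And>x. cmod x \<le> 1/2 \<Longrightarrow> cmod (exp (of_real s * Ln (1 + x))) \<le> C"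
    "\<And>x. cmod x \<le> 1/2 \<Longrightarrow> cmod (exp (of_real s * Ln (1 + x)) - 1 - of_real s * x) \<le> C * (cmod x)\<^sup>2"
proof -
  let ?S = "cball 0 (1/2) :: complex set"
  have nn: "1 + x \<notin> \<real>\<^sub>\<le>\<^sub>0" if "x \<in> ?S" for x
  proof
    assume "1 + x \<in> \<real>\<^sub>\<le>\<^sub>0"
    then have "Re (1 + x) \<le> 0" by (simp add: complex_nonpos_Reals_iff)
    then show False using that abs_Re_le_cmod[of x] by simp
  qed
  define e where "e = (\<lambda>a x. exp (of_real a * Ln (1 + x)) :: complex)"
  have ce: "continuous_on ?S (e a)" for a :: real
    unfolding e_def using nn by (intro continuous_intros) auto
  have bd: "\<exists>C\<ge>0. \<forall>x\<in>?S. cmod (e a x) \<le> C" for a :: real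
  proof -
    have "compact (e a ` ?S)" by (intro compact_continuous_image ce) auto
    then have "bounded (e a ` ?S)" by (rule compact_imp_bounded)
    then obtain C where "\<forall>x\<in>e a ` ?S. cmod x \<le> C" unfolding bounded_iff by blast
    then show ?thesis by (intro exI[of _ "max C 0"]) auto
  qed
  obtain C1 where "C1 \<ge> 0 \<and> (\<forall>x\<in>?S. cmod (e s x) \<le> C1)" using bd[of s] by (rule exE)
  then have C1: "C1 \<ge> 0" "\<And>x. x \<in> ?S \<Longrightarrow> cmod (e s x) \<le> C1" by simp_all
  obtain C2 where "C2 \<ge> 0 \<and> (\<forall>x\<in>?S. cmod (e (s - 2) x) \<le> C2)" using bd[of "s - 2"] by (rule exE)
  then have C2: "C2 \<ge> 0" "\<And>x. x \<in> ?S \<Longrightarrow> cmod (e (s - 2) x) \<le> C2" by simp_all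
  have de: "(e a has_field_derivative of_real a * e (a - 1) x) (at x within ?S)" if "x \<in> ?S" for a x
  proof -
    have "((\<lambda>x. Ln (1 + x)) has_field_derivative inverse (1 + x) * 1) (at x)"
      by (rule DERIV_chain2[where f = Ln and g = "\<lambda>x. 1 + x", OF has_field_derivative_Ln[OF nn[OF that]]]) (auto intro!: derivative_eq_intros)
    from DERIV_chain2[OF DERIV_exp DERIV_cmult[OF this, of "of_real a"]]
    have "(e a has_field_derivative e a x * (of_real a * inverse (1 + x))) (at x)"
      by (simp add: e_def)
    moreover have "1 + x \<noteq> 0" using nn[OF that] by auto
    then have "e (a - 1) x = e a x * inverse (1 + x)"
      by (simp add: e_def left_diff_distrib exp_diff divide_inverse)
    ultimately have "(e a has_field_derivative of_real a * e (a - 1) x) (at x)" by (simp add: mult_ac)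
    then show ?thesis by (rule has_field_derivative_at_within)
  qed
  define D where "D = (\<lambda>i::nat. if i = 0 then e s else if i = 1 then (\<lambda>x. of_real s * e (s - 1) x)
     else (\<lambda>x. of_real s * (of_real (s - 1) * e (s - 1 - 1) x)))"
  have T: "cmod (e s x - 1 - of_real s * x) \<le> \<bar>s\<bar> * \<bar>s - 1\<bar> * C2 * (cmod x)\<^sup>2" if x: "x \<in> ?S" for x
  proof -
    have "cmod (D 0 x - (\<Sum>i\<le>1. D i 0 * (x - 0) ^ i / (fact i))) \<le> \<bar>s\<bar> * \<bar>s - 1\<bar> * C2 * cmod (x - 0)^(Suc 1) / fact 1"
    proof (rule complex_Taylor[of ?S])
      fix i :: nat and y assume y: "y \<in> ?S" and "i \<le> 1"
      then consider "i = 0" | "i = 1" by linarith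
      then show "(D i has_field_derivative D (Suc i) y) (at y within ?S)"
      proof cases
        case 1
        then show ?thesis using de[OF y, of s] by (simp add: D_def)
      next
        case 2
        then show ?thesis using DERIV_cmult[OF de[OF y, of "s - 1"], of "of_real s"] by (simp add: D_def)
      qed
    next
      fix y assume y: "y \<in> ?S"
      have "cmod (D (Suc 1) y) = \<bar>s\<bar> * (\<bar>s - 1\<bar> * cmod (e (s - 2) y))"
        by (simp add: D_def norm_mult flip: of_real_diff)
      also have "\<dots> \<le> \<bar>s\<bar> * (\<bar>s - 1\<bar> * C2)"
        using C2(2)[OF y] by (intro mult_left_mono) auto
      finally show "cmod (D (Suc 1) y) \<le> \<bar>s\<bar> * \<bar>s - 1\<bar> * C2" by (simp add: mult.assoc)
    qed (use x in auto)
    then show ?thesis by (simp add: D_def e_def power2_eq_square diff_diff_eq)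
  qed
  show thesis
  proof (rule that[of "C1 + \<bar>s\<bar> * \<bar>s - 1\<bar> * C2"])
    fix x :: complex assume "cmod x \<le> 1/2"
    then have x: "x \<in> ?S" by simp
    show "cmod (exp (of_real s * Ln (1 + x))) \<le> C1 + \<bar>s\<bar> * \<bar>s - 1\<bar> * C2"
      using C1(2)[OF x] C2(1) by (simp add: e_def add_increasing2)
    show "cmod (exp (of_real s * Ln (1 + x)) - 1 - of_real s * x) \<le> (C1 + \<bar>s\<bar> * \<bar>s - 1\<bar> * C2) * (cmod x)\<^sup>2"
      using T[OF x] C1(1) by (simp add: e_def distrib_right add_increasing)
  qed (use C1 C2 in auto)
qed

text \<open>
  The terms of \<open>s t\<^sup>2 + d - (d + sqrt (1 - d) s t)\<^sup>2 / s\<close> add up to \<open>d\<close> times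
  \<open>1 - d / s - 2 sqrt (1 - d) t + s t\<^sup>2\<close>, a quadratic polynomial in \<open>t\<close> with minimum \<open>1 - 1 / s\<close>.
  In the application \<open>t = |b|\<close> and \<open>a = |f'(0)| / |exp (L(0))|\<close>.
\<close>

lemma deficit_lower_bound:
  fixes s d t R a :: real
  assumes s: "1 < s" and d: "0 \<le> d" "d \<le> 1" and t: "0 \<le> t"
    and a: "0 \<le> a" "a \<le> d + sqrt (1 - d) * s * t"
  shows "(1 - 1/s) * d + ((1 + t\<^sup>2 + R) powr s - 1 - s * t\<^sup>2) \<le> (1 + t\<^sup>2 + R) powr s - (1 - d) - a\<^sup>2 / s"
proof -
  define b where "b = sqrt (1 - d)"
  have b: "b\<^sup>2 = 1 - d" using d by (simp add: b_def)
  have "a\<^sup>2 / s \<le> (d + b * s * t)\<^sup>2 / s"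
    using a s by (intro divide_right_mono power_mono) (auto simp: b_def)
  also have "(d + b * s * t)\<^sup>2 / s = d\<^sup>2 / s + 2 * d * b * t + b\<^sup>2 * s * t\<^sup>2"
    using s by (simp add: power2_eq_square field_simps)
  also have "\<dots> = s * t\<^sup>2 + d / s - d * ((b - s * t)\<^sup>2 / s)"
  proof -
    define u where "u = b\<^sup>2 / s"
    have 1: "(b - s * t)\<^sup>2 / s = u - 2 * b * t + s * t\<^sup>2"
      using s by (simp add: u_def power2_eq_square field_simps)
    have 2: "d\<^sup>2 / s = d / s - d * u"
      unfolding u_def b by (simp add: power2_eq_square algebra_simps diff_divide_distrib)
    show ?thesis unfolding 1 2 b by (simp add: algebra_simps)
  qed
  also have "\<dots> \<le> s * t\<^sup>2 + d / s" using d s by simp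
  finally show ?thesis by (simp add: algebra_simps)
qed

section \<open>Comparison with the extremal profile\<close>

text \<open>
  Bessel's inequality for \<open>exp (p L / 2)\<close>.
\<close>

lemma average_exp_lower_bound:
  assumes L: "L holomorphic_on cball 0 1"
  shows "exp (p * Re (L 0)) * (1 + (p / 2 * cmod (deriv L 0))\<^sup>2) \<le> circle_average (\<lambda>z. exp (p * Re (L z)))"
proof -
  define g where "g = (\<lambda>z. exp (of_real (p/2) * L z))"
  have g: "g holomorphic_on cball 0 1" unfolding g_def by (intro holomorphic_intros L)
  have g2: "(cmod (g z))\<^sup>2 = exp (p * Re (L z))" for z
    unfolding g_def by (simp add: exp_double[symmetric])
  have "(g has_field_derivative g 0 * (of_real (p/2) * deriv L 0)) (at 0)"
    unfolding g_def using DERIV_chain2[OF DERIV_exp DERIV_cmult[OF holomorphic_at_0[OF L], of "of_real (p/2)"]] .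
  then have "deriv g 0 = g 0 * (of_real (p/2) * deriv L 0)" by (rule DERIV_imp_deriv)
  then have "(cmod (deriv g 0))\<^sup>2 = (cmod (g 0))\<^sup>2 * (p / 2 * cmod (deriv L 0))\<^sup>2"
    by (simp only: norm_mult power_mult_distrib norm_of_real power2_abs)
  then show ?thesis
    using Bessel_two_coefficients[OF g] unfolding g2 by (simp add: distrib_left)
qed

lemma affine_power_holomorphic:
  assumes "cmod b \<le> 1/2"
  shows "(\<lambda>z. exp (a * Ln (1 + b * z))) holomorphic_on cball 0 1"
    and "((\<lambda>z. exp (a * Ln (1 + b * z))) has_field_derivative a * b) (at 0)"
    and "cmod z \<le> 1 \<Longrightarrow> 1 + b * z \<noteq> 0"
proof -
  have nn: "1 + b * z \<notin> \<real>\<^sub>\<le>\<^sub>0" if "cmod z \<le> 1" for z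
  proof
    assume "1 + b * z \<in> \<real>\<^sub>\<le>\<^sub>0"
    then have "Re (1 + b * z) \<le> 0" by (simp add: complex_nonpos_Reals_iff)
    moreover have "cmod (b * z) \<le> 1/2 * 1"
      unfolding norm_mult using assms that by (intro mult_mono) auto
    ultimately show False using abs_Re_le_cmod[of "b * z"] by simp
  qed
  show "(\<lambda>z. exp (a * Ln (1 + b * z))) holomorphic_on cball 0 1"
    by (intro holomorphic_intros) (use nn in auto)
  have "((\<lambda>z. Ln (1 + b * z)) has_field_derivative inverse (1 + b * 0) * b) (at 0)"
    by (rule DERIV_chain2[where f = Ln and g = "\<lambda>z. 1 + b * z", OF has_field_derivative_Ln])
       (use nn[of 0] in \<open>auto intro!: derivative_eq_intros\<close>)
  from DERIV_chain2[OF DERIV_exp DERIV_cmult[OF this, of a]]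
  show "((\<lambda>z. exp (a * Ln (1 + b * z))) has_field_derivative a * b) (at 0)" by simp
  show "cmod z \<le> 1 \<Longrightarrow> 1 + b * z \<noteq> 0" using nn[of z] by auto
qed

text \<open>
  \<open>W\<close> is the relative deviation of the \<open>n\<close>-th root of \<open>exp (L - L 0)\<close> from the \<open>n\<close>-th root of
  \<open>(1 + b z)\<^bsup>2/p\<^esup>\<close>. The choice of \<open>b\<close> makes it vanish to second order at 0. Integrating \<open>powr_convexity\<close>
  for \<open>W\<close> against the weight \<open>|1 + b z|\<^sup>2\<close>, which is at least 1/4, therefore leaves only the average
  \<open>1 + |b|\<^sup>2\<close> of the weight and the remainder.
\<close>

lemma convexity_remainder_le_Bessel_gap:
  fixes p :: real and n :: nat
  assumes L: "L holomorphic_on cball 0 1" and p: "0 < p" and n: "n \<ge> 1" and q: "1 < n * p" "n * p \<le> 2"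
    and b: "b = of_real (p / 2) * deriv L 0" "cmod b \<le> 1/2"
  defines "W \<equiv> (\<lambda>z. exp ((L z - L 0) / of_nat n) * exp (- of_real (2 / (n * p)) * Ln (1 + b * z)) - 1)"
  shows "continuous_on (sphere 0 1) W"
    and "circle_average (\<lambda>z. (cmod (W z))\<^sup>2 * (1 + cmod (W z)) powr (n * p - 2))
      \<le> 8 / (n * p * (n * p - 1)) *
        (circle_average (\<lambda>z. exp (p * Re (L z))) / exp (p * Re (L 0)) - 1 - (cmod b)\<^sup>2)"
    and "cmod z \<le> 1 \<Longrightarrow> exp (L z) = exp (L 0) * exp (of_real (2 / p) * Ln (1 + b * z)) * (1 + W z) ^ n"
proof -
  define r where "r = n * p"
  have r: "1 < r" "r \<le> 2" "r = n * p" using q by (auto simp: r_def)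
  define P where "P = (\<lambda>z. exp (- of_real (2 / r) * Ln (1 + b * z)))"
  have P: "P holomorphic_on cball 0 1" "(P has_field_derivative (- of_real (2 / r)) * b) (at 0)"
    using affine_power_holomorphic[OF b(2), of "- of_real (2 / r)"] unfolding P_def by blast+
  have W_eq: "W z = exp ((L z - L 0) / of_nat n) * P z - 1" for z
    by (simp add: W_def P_def r_def)
  then have W_fun: "W = (\<lambda>z. exp ((L z - L 0) / of_nat n) * P z - 1)" by auto
  have holW: "W holomorphic_on cball 0 1"
    unfolding W_fun using n by (intro holomorphic_intros L P) auto
  show cW: "continuous_on (sphere 0 1) W" by (rule continuous_on_circle[OF holW])
  have W0: "W 0 = 0" by (simp add: W_eq P_def)
  have "((\<lambda>z. (L z - L 0) / of_nat n) has_field_derivative deriv L 0 / of_nat n) (at 0)"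
    using DERIV_cdivide[OF DERIV_diff[OF holomorphic_at_0[OF L] DERIV_const[of "L 0"]], of "of_nat n"] by simp
  from DERIV_diff[OF DERIV_mult[OF DERIV_chain2[OF DERIV_exp this] P(2)] DERIV_const[of 1]]
  have "(W has_field_derivative deriv L 0 / of_nat n - of_real (2 / r) * b) (at 0)"
    unfolding W_fun by (simp add: P_def)
  moreover have "of_real (2 / r) * b = deriv L 0 / of_nat n"
    using p n by (simp add: r_def b(1))
  ultimately have W1: "deriv W 0 = 0" by (simp add: DERIV_imp_deriv)
  have ne: "1 + b * z \<noteq> 0" if "cmod z \<le> 1" for z
    using affine_power_holomorphic(3)[OF b(2) that] .
  have exp_n: "exp (w / of_nat n) ^ n = exp w" for w :: complex
    using n exp_of_nat_mult[of n "w / of_nat n"] by simp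
  show "exp (L z) = exp (L 0) * exp (of_real (2 / p) * Ln (1 + b * z)) * (1 + W z) ^ n" if "cmod z \<le> 1"
  proof -
    have "P z ^ n = exp (- of_real (2 / p) * Ln (1 + b * z))"
      unfolding P_def using n p by (subst exp_of_nat_mult[symmetric]) (simp add: r_def field_simps)
    then have "(1 + W z) ^ n = exp (L z - L 0) * exp (- of_real (2 / p) * Ln (1 + b * z))"
      by (simp add: W_eq power_mult_distrib exp_n)
    then show ?thesis by (simp add: exp_diff exp_minus field_simps)
  qed
  have modulus: "(cmod (1 + b * z))\<^sup>2 * cmod (1 + W z) powr r = exp (p * Re (L z)) / exp (p * Re (L 0))"
    if "cmod z = 1" for z
  proof -
    have nz: "1 + b * z \<noteq> 0" using ne that by simp
    have "cmod (1 + W z) powr r = cmod (exp ((L z - L 0) / of_nat n)) powr r * cmod (P z) powr r"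
      by (simp add: W_eq norm_mult powr_mult)
    also have "cmod (exp ((L z - L 0) / of_nat n)) powr r = exp (r * (Re (L z - L 0) / n))"
      unfolding cmod_exp_powr by simp
    also have "\<dots> = exp (p * Re (L z)) / exp (p * Re (L 0))"
    proof -
      have "r * (Re (L z - L 0) / n) = p * Re (L z) - p * Re (L 0)"
        using n by (simp add: r_def algebra_simps add_divide_distrib diff_divide_distrib)
      then show ?thesis by (simp add: exp_diff)
    qed
    also have "cmod (P z) powr r = exp (r * (- (2 / r) * ln (cmod (1 + b * z))))"
      unfolding P_def cmod_exp_powr using nz by simp
    also have "\<dots> = inverse ((cmod (1 + b * z))\<^sup>2)"
      using r(1) nz by (simp add: exp_minus exp_double)
    finally show ?thesis using nz by simp
  qed
  define E where "E = (\<lambda>z. (cmod (W z))\<^sup>2 * (1 + cmod (W z)) powr (r - 2))"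
  have cE: "continuous_on (sphere 0 1) E"
    unfolding E_def by (intro continuous_intros cW) (simp add: add_nonneg_eq_0_iff)
  have cexp: "continuous_on (sphere 0 1) (\<lambda>z. exp (p * Re (L z)))"
    by (intro continuous_intros continuous_on_circle[OF L])
  have E0: "E z \<ge> 0" for z by (simp add: E_def)
  define k where "k = r * (r - 1) / 2"
  have k: "k > 0" using r by (simp add: k_def)
  have "(1 + (cmod b)\<^sup>2) + k / 4 * circle_average E
     = circle_average (\<lambda>z. ((cmod (1 + b * z))\<^sup>2 + r * ((cmod (1 + b * z))\<^sup>2 * Re (W z))) + k / 4 * E z)"
  proof -
    have "circle_average (\<lambda>z. ((cmod (1 + b * z))\<^sup>2 + r * ((cmod (1 + b * z))\<^sup>2 * Re (W z))) + k / 4 * E z)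
      = circle_average (\<lambda>z. (cmod (1 + b * z))\<^sup>2 + r * ((cmod (1 + b * z))\<^sup>2 * Re (W z)))
        + circle_average (\<lambda>z. k / 4 * E z)"
      by (rule circle_average_add) (intro continuous_intros cW cE)+
    also have "circle_average (\<lambda>z. k / 4 * E z) = k / 4 * circle_average E"
      by (rule circle_average_mult_left)
    also have "circle_average (\<lambda>z. (cmod (1 + b * z))\<^sup>2 + r * ((cmod (1 + b * z))\<^sup>2 * Re (W z)))
      = circle_average (\<lambda>z. (cmod (1 + b * z))\<^sup>2) + circle_average (\<lambda>z. r * ((cmod (1 + b * z))\<^sup>2 * Re (W z)))"
      by (rule circle_average_add) (intro continuous_intros cW)+
    also have "circle_average (\<lambda>z. r * ((cmod (1 + b * z))\<^sup>2 * Re (W z)))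
      = r * circle_average (\<lambda>z. (cmod (1 + b * z))\<^sup>2 * Re (W z))"
      by (rule circle_average_mult_left)
    also have "circle_average (\<lambda>z. (cmod (1 + b * z))\<^sup>2 * Re (W z)) = 0"
      by (rule weighted_average_vanishing[OF holW W0 W1])
    finally show ?thesis by (simp add: average_square_affine)
  qed
  also have "\<dots> \<le> circle_average (\<lambda>z. 1 / exp (p * Re (L 0)) * exp (p * Re (L z)))"
  proof (rule circle_average_mono)
    fix z :: complex assume z: "cmod z = 1"
    have "cmod (b * z) \<le> 1/2" using z b(2) by (simp add: norm_mult)
    then have "1/2 \<le> cmod (1 + b * z)"
      using norm_triangle_ineq4[of "1 + b * z" "b * z"] by simp
    then have "(1/2)\<^sup>2 \<le> (cmod (1 + b * z))\<^sup>2" by (rule power_mono) auto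
    then have "k * (1/4 * E z) \<le> k * ((cmod (1 + b * z))\<^sup>2 * E z)"
      using k E0[of z] by (intro mult_left_mono mult_right_mono) (auto simp: power2_eq_square)
    then have "((cmod (1 + b * z))\<^sup>2 + r * ((cmod (1 + b * z))\<^sup>2 * Re (W z))) + k / 4 * E z
      \<le> (cmod (1 + b * z))\<^sup>2 * (1 + r * Re (W z) + k * E z)"
      by (simp add: algebra_simps)
    also have "\<dots> \<le> (cmod (1 + b * z))\<^sup>2 * cmod (1 + W z) powr r"
      using powr_convexity[OF r(1,2), of "W z"] by (intro mult_left_mono) (auto simp: E_def k_def)
    also have "\<dots> = 1 / exp (p * Re (L 0)) * exp (p * Re (L z))"
      by (simp add: modulus[OF z])
    finally show "((cmod (1 + b * z))\<^sup>2 + r * ((cmod (1 + b * z))\<^sup>2 * Re (W z))) + k / 4 * E z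
      \<le> 1 / exp (p * Re (L 0)) * exp (p * Re (L z))" .
  qed (intro continuous_intros cW cE cexp)+
  also have "\<dots> = circle_average (\<lambda>z. exp (p * Re (L z))) / exp (p * Re (L 0))"
    by (subst circle_average_mult_left) simp
  finally have fin: "(1 + (cmod b)\<^sup>2) + k / 4 * circle_average E
    \<le> circle_average (\<lambda>z. exp (p * Re (L z))) / exp (p * Re (L 0))" .
  define Q where "Q = circle_average (\<lambda>z. exp (p * Re (L z))) / exp (p * Re (L 0)) - 1 - (cmod b)\<^sup>2"
  have "k * circle_average E \<le> 4 * Q" using fin by (simp add: Q_def)
  then have "circle_average E \<le> 4 * Q / k" using k by (simp add: pos_le_divide_eq mult.commute)
  also have "4 * Q / k = 8 / (r * (r - 1)) * Q" by (simp add: k_def)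
  finally show "circle_average (\<lambda>z. (cmod (W z))\<^sup>2 * (1 + cmod (W z)) powr (n * p - 2))
      \<le> 8 / (n * p * (n * p - 1)) *
        (circle_average (\<lambda>z. exp (p * Re (L z))) / exp (p * Re (L 0)) - 1 - (cmod b)\<^sup>2)"
    unfolding E_def Q_def r(3) .
qed

lemma norm_one_plus_power_minus_one_le: "cmod ((1 + w) ^ n - 1) \<le> (1 + cmod w) ^ n - 1"
proof (induction n)
  case (Suc n)
  have "(1 + w) ^ Suc n - 1 = (1 + w) * ((1 + w) ^ n - 1) + w" by (simp add: algebra_simps)
  also have "cmod \<dots> \<le> (1 + cmod w) * ((1 + cmod w) ^ n - 1) + cmod w"
    using Suc norm_triangle_ineq[of 1 w]
    by (intro order_trans[OF norm_triangle_ineq] add_mono) (auto simp: norm_mult intro!: mult_mono)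
  finally show ?case by (simp add: algebra_simps)
qed auto

text \<open>
  In the application \<open>P = (1 + b z)\<^bsup>2/p\<^esup>\<close>, \<open>x = (2/p) b z\<close>, \<open>w = W z\<close> and \<open>t = |b|\<close>, while \<open>Bz\<close>, \<open>B0\<close> and
  \<open>B1\<close> are \<open>B z\<close>, \<open>B 0\<close> and \<open>deriv B 0\<close>. Then the left-hand side is \<open>|f z - f 0 - deriv f 0 * z|\<^sup>p\<close> up to the
  factor \<open>|exp (L 0)|\<^sup>p\<close>. The expression is split by replacing \<open>Bz\<close>, \<open>(1 + w)\<^sup>n\<close> and \<open>P\<close> one
  after the other by \<open>B0\<close>, \<open>1\<close> and \<open>1 + x\<close>.
\<close>

lemma pointwise_remainder_bound:
  fixes p :: real and n :: nat
  assumes p: "0 < p" "p \<le> 2" and n: "n \<ge> 1" and q: "1 < n * p" "n * p \<le> 2" and C0: "0 \<le> C0"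
    and P: "cmod P \<le> C0" "cmod (P - 1 - x) \<le> C0 * t\<^sup>2"
    and B: "cmod Bz \<le> 1" "cmod B0 \<le> 1" "cmod B1 \<le> d" and z: "cmod z = 1"
    and l: "0 < l" "l \<le> 1" "t\<^sup>2 \<le> l" "d \<le> l\<^sup>2"
  shows "cmod (Bz * P * (1 + w) ^ n - B0 - B1 * z - B0 * x) powr p
    \<le> 9 * (3 * C0 * 2 ^ n + C0 + 1) powr p * (10 * l powr p + l powr (p - 2) *
        ((cmod (Bz - B0))\<^sup>2 + 8 * ((cmod w)\<^sup>2 * (1 + cmod w) powr (n * p - 2))))"
proof -
  define h where "h = cmod w"
  define K where "K = 3 * C0 * 2 ^ n + C0 + 1"
  have h: "h \<ge> 0" by (simp add: h_def)
  have K: "0 \<le> K" "C0 \<le> K" "3 * C0 * 2 ^ n \<le> K" "C0 + 1 \<le> K" using C0 by (auto simp: K_def)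
  have d: "d \<le> l" using l(4) power_decreasing[of 1 2 l] l by simp
  have U: "cmod ((1 + w) ^ n - 1) \<le> 2 ^ n * (h + h ^ n)"
    using norm_one_plus_power_minus_one_le[of w n] one_plus_power_le[OF h n] by (simp add: h_def)
  have "Bz * P * (1 + w) ^ n - B0 - B1 * z - B0 * x
     = (Bz - B0) * P + (Bz - B0) * P * ((1 + w) ^ n - 1) + B0 * P * ((1 + w) ^ n - 1)
        + (B0 * (P - 1 - x) - B1 * z)"
    by (simp add: algebra_simps)
  also have "cmod \<dots> \<le> cmod (Bz - B0) * C0 + 2 * C0 * (2 ^ n * (h + h ^ n)) + 1 * C0 * (2 ^ n * (h + h ^ n))
       + (1 * (C0 * t\<^sup>2) + d * 1)"
  proof (intro norm_triangle_mono)
    show "cmod ((Bz - B0) * P) \<le> cmod (Bz - B0) * C0"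
      unfolding norm_mult by (intro mult_left_mono P) auto
    have "cmod (Bz - B0) \<le> 2" using norm_triangle_ineq4[of Bz B0] B by simp
    then show "cmod ((Bz - B0) * P * ((1 + w) ^ n - 1)) \<le> 2 * C0 * (2 ^ n * (h + h ^ n))"
      unfolding norm_mult using C0 by (intro mult_mono P U) auto
    show "cmod (B0 * P * ((1 + w) ^ n - 1)) \<le> 1 * C0 * (2 ^ n * (h + h ^ n))"
      unfolding norm_mult using C0 by (intro mult_mono P U B) auto
    have "cmod (B0 * (P - 1 - x)) \<le> 1 * (C0 * t\<^sup>2)"
      unfolding norm_mult by (intro mult_mono P B) auto
    moreover have "cmod (B1 * z) \<le> d * 1"
      unfolding norm_mult using B z by simp
    ultimately show "cmod (B0 * (P - 1 - x) - B1 * z) \<le> 1 * (C0 * t\<^sup>2) + d * 1"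
      using norm_triangle_ineq4[of "B0 * (P - 1 - x)" "B1 * z"] by linarith
  qed
  also have "\<dots> = C0 * cmod (Bz - B0) + (3 * C0 * 2 ^ n) * (h + h ^ n) + (C0 * t\<^sup>2 + d)"
    by (simp add: algebra_simps)
  also have "\<dots> \<le> C0 * cmod (Bz - B0) + (3 * C0 * 2 ^ n) * (h + h ^ n) + (C0 + 1) * l"
    using mult_left_mono[OF l(3) C0] d by (simp add: algebra_simps)
  also have "\<dots> \<le> K * cmod (Bz - B0) + K * (h + h ^ n) + K * l"
    using K h l by (intro add_mono mult_right_mono) auto
  finally have le: "cmod (Bz * P * (1 + w) ^ n - B0 - B1 * z - B0 * x) \<le> K * (cmod (Bz - B0) + (h + h ^ n) + l)"
    by (simp add: algebra_simps)
  have "cmod (Bz * P * (1 + w) ^ n - B0 - B1 * z - B0 * x) powr p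
      \<le> (K * (cmod (Bz - B0) + (h + h ^ n) + l)) powr p"
    using p by (intro powr_mono2 le) auto
  also have "\<dots> = K powr p * (cmod (Bz - B0) + (h + h ^ n) + l) powr p"
    using K h l by (simp add: powr_mult)
  also have "\<dots> \<le> K powr p * (9 * (cmod (Bz - B0) powr p + (h + h ^ n) powr p + l powr p))"
    using h l p by (intro mult_left_mono powr_add3_le) auto
  also have "\<dots> \<le> K powr p * (9 * ((l powr p + l powr (p - 2) * (cmod (Bz - B0))\<^sup>2)
      + 8 * (l powr p + l powr (p - 2) * (h\<^sup>2 * (1 + h) powr (n * p - 2))) + l powr p))"
    by (intro mult_left_mono add_mono powr_le_Young powr_sum_power_le_Young)
       (use h l p n q in auto)
  also have "\<dots> = 9 * K powr p * (10 * l powr p + l powr (p - 2) *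
        ((cmod (Bz - B0))\<^sup>2 + 8 * (h\<^sup>2 * (1 + h) powr (n * p - 2))))"
    by (simp add: algebra_simps)
  finally show ?thesis unfolding K_def h_def .
qed

lemma exists_multiple_in_1_2:
  fixes p :: real
  assumes "0 < p" "p \<le> 2"
  obtains n :: nat where "n \<ge> 1" "1 < n * p" "n * p \<le> 2"
proof (cases "1 < p")
  case True
  then show ?thesis using that[of 1] assms by simp
next
  case False
  define n where "n = nat \<lfloor>2 / p\<rfloor>"
  have n: "real n \<le> 2 / p" "2 / p < real n + 1"
    using assms by (simp_all add: n_def floor_less_iff)
  then have "n * p \<le> 2" "2 < n * p + p" using assms by (simp_all add: field_simps)
  moreover from this have "n \<ge> 1" using False by (cases n) auto
  ultimately show ?thesis using that[of n] False by simp
qed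

text \<open>
  The number \<open>l\<^sup>2\<close> is an upper bound for \<open>d\<close>, \<open>R\<close> and \<open>|b|\<^sup>4\<close>. It is kept separate from their maximum,
  because that may vanish whereas the Young inequalities require \<open>l > 0\<close>.
\<close>

lemma near_constant_remainder_bound:
  fixes p :: real
  assumes p: "0 < p" "p \<le> 2"
  obtains C where "0 < C"
    "\<forall>B L b l. B holomorphic_on cball 0 1 \<longrightarrow>
       (\<forall>z. cmod z = 1 \<longrightarrow> cmod (B z) = 1) \<longrightarrow>
       L holomorphic_on cball 0 1 \<longrightarrow>
       b = of_real (p / 2) * deriv L 0 \<longrightarrow>
       cmod b \<le> 1/2 \<longrightarrow>
       0 < l \<longrightarrow>
       l \<le> 1 \<longrightarrow>
       (cmod b)\<^sup>2 \<le> l \<longrightarrow>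
       1 - (cmod (B 0))\<^sup>2 \<le> l\<^sup>2 \<longrightarrow>
       circle_average (\<lambda>z. exp (p * Re (L z))) / exp (p * Re (L 0)) - 1 - (cmod b)\<^sup>2 \<le> l\<^sup>2
       \<longrightarrow> circle_average (\<lambda>z. cmod (B z * exp (L z) - B 0 * exp (L 0)
            - exp (L 0) * (deriv B 0 + B 0 * (of_real (2 / p) * b)) * z) powr p)
         \<le> C * exp (p * Re (L 0)) * l powr p"
proof -
  obtain n :: nat where n: "n \<ge> 1" and q: "1 < n * p" "n * p \<le> 2"
    using exists_multiple_in_1_2[OF p] .
  obtain C0 where C0: "0 \<le> C0"
    "\<And>x. cmod x \<le> 1/2 \<Longrightarrow> cmod (exp (of_real (2 / p) * Ln (1 + x))) \<le> C0"
    "\<And>x. cmod x \<le> 1/2 \<Longrightarrow> cmod (exp (of_real (2 / p) * Ln (1 + x)) - 1 - of_real (2 / p) * x) \<le> C0 * (cmod x)\<^sup>2"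
    by (rule complex_power_Taylor_bound[of "2 / p"], rule that)
  define K where "K = 9 * (3 * C0 * 2 ^ n + C0 + 1) powr p"
  define M where "M = 8 / (n * p * (n * p - 1))"
  have "3 * C0 * 2 ^ n + C0 + 1 > 0" using C0(1) by (simp add: add_nonneg_pos)
  then have K: "K > 0" by (simp add: K_def)
  have M: "M > 0" using q by (simp add: M_def)
  show thesis
  proof (rule that[of "K * (11 + 8 * M)"]; (intro allI impI)?)
    show "0 < K * (11 + 8 * M)" using K M by simp
  next
    fix B L b l
    assume B': "B holomorphic_on cball 0 1" "\<forall>z. cmod z = 1 \<longrightarrow> cmod (B z) = 1"
      and L: "L holomorphic_on cball 0 1" and b: "b = of_real (p / 2) * deriv L 0" "cmod b \<le> 1/2"
      and l: "0 < l" "l \<le> 1" "(cmod b)\<^sup>2 \<le> l" "1 - (cmod (B 0))\<^sup>2 \<le> l\<^sup>2"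
      and R: "circle_average (\<lambda>z. exp (p * Re (L z))) / exp (p * Re (L 0)) - 1 - (cmod b)\<^sup>2 \<le> l\<^sup>2"
    note B = B'(1) B'(2)[rule_format]
    define W where "W = (\<lambda>z. exp ((L z - L 0) / of_nat n) * exp (- of_real (2 / (n * p)) * Ln (1 + b * z)) - 1)"
    note Wf = convexity_remainder_le_Bessel_gap[OF L p(1) n q b]
    have cW [continuous_intros]: "continuous_on (sphere 0 1) W" unfolding W_def by (rule Wf(1))
    note cB [continuous_intros] = continuous_on_circle[OF B(1)]
    note cL [continuous_intros] = continuous_on_circle[OF L]
    define E where "E = (\<lambda>z. (cmod (W z))\<^sup>2 * (1 + cmod (W z)) powr (n * p - 2))"
    have cE [continuous_intros]: "continuous_on (sphere 0 1) E"
      unfolding E_def by (intro continuous_intros) (simp add: add_nonneg_eq_0_iff)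
    have "circle_average E \<le> M * (circle_average (\<lambda>z. exp (p * Re (L z))) / exp (p * Re (L 0)) - 1 - (cmod b)\<^sup>2)"
      using Wf(2) unfolding E_def M_def W_def .
    also have "\<dots> \<le> M * l\<^sup>2" using R M by (intro mult_left_mono) auto
    finally have E: "circle_average E \<le> M * l\<^sup>2" .
    define X where "X = exp (p * Re (L 0))"
    have X: "X > 0" by (simp add: X_def)
    define F where "F = (\<lambda>z. B z * exp (L z) - B 0 * exp (L 0)
            - exp (L 0) * (deriv B 0 + B 0 * (of_real (2 / p) * b)) * z)"
    define c1 where "c1 = X * (K * (10 * l powr p))"
    define c2 where "c2 = X * (K * l powr (p - 2))"
    have "circle_average (\<lambda>z. cmod (F z) powr p) \<le> circle_average (\<lambda>z. c1 + c2 * ((cmod (B z - B 0))\<^sup>2 + 8 * E z))"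
    proof (rule circle_average_mono)
      show "continuous_on (sphere 0 1) (\<lambda>z. cmod (F z) powr p)"
        unfolding F_def by (intro continuous_on_powr' continuous_intros) (use p in auto)
      fix z :: complex assume z: "cmod z = 1"
      define P where "P = exp (of_real (2 / p) * Ln (1 + b * z))"
      have bz: "cmod (b * z) = cmod b" using z by (simp add: norm_mult)
      have "exp (L z) = exp (L 0) * P * (1 + W z) ^ n"
        using Wf(3)[of z] z unfolding W_def P_def by simp
      then have "F z = exp (L 0) * (B z * P * (1 + W z) ^ n - B 0 - deriv B 0 * z - B 0 * (of_real (2 / p) * (b * z)))"
        by (simp add: F_def algebra_simps)
      then have "cmod (F z) powr p = X * cmod (B z * P * (1 + W z) ^ n - B 0 - deriv B 0 * z
          - B 0 * (of_real (2 / p) * (b * z))) powr p"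
        unfolding X_def cmod_exp_powr[symmetric] by (simp add: norm_mult powr_mult)
      also have "\<dots> \<le> X * (K * (10 * l powr p + l powr (p - 2) * ((cmod (B z - B 0))\<^sup>2 + 8 * E z)))"
        unfolding K_def E_def
      proof (intro mult_left_mono pointwise_remainder_bound[OF p n q C0(1)])
        show "cmod P \<le> C0" "cmod (P - 1 - of_real (2 / p) * (b * z)) \<le> C0 * (cmod b)\<^sup>2"
          using C0(2,3)[of "b * z"] b(2) unfolding P_def bz by auto
        show "cmod (deriv B 0) \<le> 1 - (cmod (B 0))\<^sup>2" by (rule inner_deriv_bound(2)[OF B])
      qed (use B z l X inner_deriv_bound(1)[OF B] in auto)
      also have "\<dots> = c1 + c2 * ((cmod (B z - B 0))\<^sup>2 + 8 * E z)"
        by (simp add: c1_def c2_def algebra_simps)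
      finally show "cmod (F z) powr p \<le> c1 + c2 * ((cmod (B z - B 0))\<^sup>2 + 8 * E z)" .
    qed (intro continuous_intros)+
    also have "\<dots> = c1 + c2 * ((1 - (cmod (B 0))\<^sup>2) + 8 * circle_average E)"
    proof -
      have "circle_average (\<lambda>z. c1 + c2 * ((cmod (B z - B 0))\<^sup>2 + 8 * E z))
        = circle_average (\<lambda>z. c1) + circle_average (\<lambda>z. c2 * ((cmod (B z - B 0))\<^sup>2 + 8 * E z))"
        by (rule circle_average_add) (intro continuous_intros)+
      also have "circle_average (\<lambda>z. c2 * ((cmod (B z - B 0))\<^sup>2 + 8 * E z))
        = c2 * circle_average (\<lambda>z. (cmod (B z - B 0))\<^sup>2 + 8 * E z)"
        by (rule circle_average_mult_left)
      also have "circle_average (\<lambda>z. (cmod (B z - B 0))\<^sup>2 + 8 * E z)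
        = circle_average (\<lambda>z. (cmod (B z - B 0))\<^sup>2) + circle_average (\<lambda>z. 8 * E z)"
        by (rule circle_average_add) (intro continuous_intros)+
      also have "circle_average (\<lambda>z. 8 * E z) = 8 * circle_average E"
        by (rule circle_average_mult_left)
      also have "circle_average (\<lambda>z. (cmod (B z - B 0))\<^sup>2) = circle_average (\<lambda>z. (cmod (B z))\<^sup>2) - (cmod (B 0))\<^sup>2"
        by (rule average_square_minus_const[OF B(1)])
      also have "circle_average (\<lambda>z. (cmod (B z))\<^sup>2) = circle_average (\<lambda>z. 1)"
        by (rule circle_average_cong) (simp add: B(2))
      finally show ?thesis by simp
    qed
    also have "\<dots> \<le> c1 + c2 * (l\<^sup>2 + 8 * (M * l\<^sup>2))"
      using l(4) E X K by (intro add_left_mono mult_left_mono add_mono) (auto simp: c2_def)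
    also have "\<dots> = K * (11 + 8 * M) * X * l powr p"
    proof -
      have "l powr (p - 2) * l\<^sup>2 = l powr p"
        using l powr_add[of l "p - 2" 2] by (simp add: powr_numeral)
      then have "c2 * l\<^sup>2 = X * K * l powr p" by (simp add: c2_def)
      moreover have "c2 * (l\<^sup>2 + 8 * (M * l\<^sup>2)) = (1 + 8 * M) * (c2 * l\<^sup>2)" by (simp add: algebra_simps)
      ultimately show ?thesis by (simp add: c1_def algebra_simps)
    qed
    finally show "circle_average (\<lambda>z. cmod (B z * exp (L z) - B 0 * exp (L 0)
            - exp (L 0) * (deriv B 0 + B 0 * (of_real (2 / p) * b)) * z) powr p)
         \<le> K * (11 + 8 * M) * exp (p * Re (L 0)) * l powr p"
      unfolding F_def X_def .
  qed
qed

section \<open>Stability on a zero-free circle\<close>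

text \<open>
  The passage from the mean \<open>H\<close> of \<open>|f(z) - f(0) - f'(0) z|\<^sup>p\<close> to the deficit, as a statement on real
  numbers, where \<open>t = |b|\<close> and \<open>a = |f'(0)| / |exp (L(0))|\<close>. The first bound for \<open>H\<close> is the triangle
  inequality, used when \<open>|b|\<^sup>2 + R \<ge> 1/4\<close>; the second one, used otherwise, is that of
  \<open>near_constant_remainder_bound\<close>.
\<close>

lemma deficit_dominates:
  fixes s C0 :: real
  assumes s: "1 < s" and C0: "0 < C0"
  obtains C where "0 < C"
    "\<forall>X A H d t a. 0 < X \<longrightarrow>
       0 \<le> H \<longrightarrow>
       0 \<le> d \<longrightarrow>
       d \<le> 1 \<longrightarrow>
       0 \<le> t \<longrightarrow>
       0 \<le> a \<longrightarrow>
       a \<le> d + sqrt (1 - d) * s * t \<longrightarrow>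
       X * (1 + t\<^sup>2) \<le> A \<longrightarrow>
       H \<le> 9 * (A + X + a powr (2 / s) * X) \<longrightarrow>
       (\<forall>l. 0 < l \<longrightarrow> l \<le> 1 \<longrightarrow> t \<le> 1/2 \<longrightarrow> t\<^sup>2 \<le> l \<longrightarrow> d \<le> l\<^sup>2 \<longrightarrow> A / X - 1 - t\<^sup>2 \<le> l\<^sup>2
          \<longrightarrow> H \<le> C0 * X * l powr (2 / s))
       \<longrightarrow> H powr s \<le> C * (A powr s - (1 - d) * X powr s - a\<^sup>2 / s * X powr s)"
proof -
  obtain c2 where c2: "0 < c2" "\<And>z. 1/4 \<le> z \<Longrightarrow> c2 * (1 + z) powr s \<le> (1 + z) powr s - 1 - s * z"
    by (rule Bernoulli_strict_uniform[OF s], rule that)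
  define c1 where "c1 = s * (s - 1) / 4"
  have "0 < c1" using s by (simp add: c1_def)
  define m where "m = min (1 - 1/s) (min c1 s)"
  have m: "0 < m" "m \<le> 1 - 1/s" "m \<le> c1" "m \<le> s"
    using s \<open>0 < c1\<close> by (auto simp: m_def)
  define C1 where "C1 = (9 * (2 + s)) powr s / c2"
  define C2 where "C2 = C0 powr s / m"
  have C1: "0 \<le> C1" and C2: "0 < C2" using c2 m C0 by (auto simp: C1_def C2_def)
  show thesis
  proof (rule that[of "C1 + C2"]; (intro allI impI)?)
    show "0 < C1 + C2" using C1 C2 by simp
  next
    fix X A H d t a :: real
    assume X: "0 < X" and H: "0 \<le> H" and d: "0 \<le> d" "d \<le> 1" and t: "0 \<le> t" and a: "0 \<le> a" "a \<le> d + sqrt (1 - d) * s * t"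
      and XA: "X * (1 + t\<^sup>2) \<le> A" and H1: "H \<le> 9 * (A + X + a powr (2 / s) * X)"
      and H2: "\<forall>l. 0 < l \<longrightarrow>
       l \<le> 1 \<longrightarrow>
       t \<le> 1/2 \<longrightarrow>
       t\<^sup>2 \<le> l \<longrightarrow>
       d \<le> l\<^sup>2 \<longrightarrow>
       A / X - 1 - t\<^sup>2 \<le> l\<^sup>2
       \<longrightarrow> H \<le> C0 * X * l powr (2 / s)"
    define R where "R = A / X - 1 - t\<^sup>2"
    define Z where "Z = t\<^sup>2 + R"
    define V where "V = (1 + Z) powr s - (1 - d) - a\<^sup>2 / s"
    have R: "0 \<le> R" using XA X by (simp add: R_def field_simps)
    have Z: "0 \<le> Z" "t\<^sup>2 \<le> Z" using R by (auto simp: Z_def)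
    have A: "A = X * (1 + Z)" using X by (simp add: Z_def R_def)
    have As: "A powr s = X powr s * (1 + Z) powr s"
      unfolding A using X Z by (simp add: powr_mult)
    have V_eq: "A powr s - (1 - d) * X powr s - a\<^sup>2 / s * X powr s = X powr s * V"
      by (simp add: As V_def algebra_simps)
    have V: "(1 - 1/s) * d + ((1 + Z) powr s - 1 - s * Z) + s * R \<le> V"
      using deficit_lower_bound[OF s d t a, of R] by (simp add: V_def Z_def algebra_simps)
    have sd: "0 \<le> (1 - 1/s) * d" and sR: "0 \<le> s * R" using s d R by auto
    show "H powr s \<le> (C1 + C2) * (A powr s - (1 - d) * X powr s - a\<^sup>2 / s * X powr s)"
    proof (cases "1/4 \<le> Z")
      case True
      have V2: "c2 * (1 + Z) powr s \<le> V" using c2(2)[OF True] V sd sR by linarith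
      moreover have "0 \<le> c2 * (1 + Z) powr s" using c2 by simp
      ultimately have V0: "0 \<le> V" by linarith
      then have "a\<^sup>2 / s \<le> (1 + Z) powr s" using d by (simp add: V_def)
      then have "a\<^sup>2 \<le> s * (1 + Z) powr s" using s by (simp add: field_simps)
      then have "(a\<^sup>2) powr (1/s) \<le> (s * (1 + Z) powr s) powr (1/s)"
        using s by (intro powr_mono2) auto
      also have "\<dots> = s powr (1/s) * (1 + Z)"
        using s Z by (simp add: powr_mult powr_powr)
      also have "\<dots> \<le> s powr 1 * (1 + Z)"
        using s Z by (intro mult_right_mono powr_mono) auto
      also have "(a\<^sup>2) powr (1/s) = a powr (2 / s)"
        using a(1) powr_powr[of a 2 "1/s"] by (cases "a = 0") (simp_all add: powr_numeral)
      finally have "a powr (2 / s) \<le> s * (1 + Z)" using s by simp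
      then have "a powr (2 / s) * X \<le> s * (1 + Z) * X" using X by (intro mult_right_mono) auto
      moreover have "X \<le> A" using A X Z by (simp add: algebra_simps)
      ultimately have "H \<le> 9 * (2 + s) * A" using H1 by (simp add: A algebra_simps)
      then have "H powr s \<le> (9 * (2 + s) * A) powr s" using H s by (intro powr_mono2) auto
      also have "\<dots> = (9 * (2 + s)) powr s * A powr s"
        using s X Z by (intro powr_mult)
      also have "\<dots> = C1 * (X powr s * (c2 * (1 + Z) powr s))"
        using c2(1) by (simp add: C1_def As)
      also have "\<dots> \<le> C1 * (X powr s * V)" using C1 by (intro mult_left_mono V2) auto
      also have "\<dots> \<le> (C1 + C2) * (X powr s * V)" using C2 V0 by (intro mult_right_mono) auto
      finally show ?thesis unfolding V_eq .
    next
      case False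
      have B2: "c1 * Z\<^sup>2 \<le> (1 + Z) powr s - 1 - s * Z"
        unfolding c1_def using Z False by (intro Bernoulli_second_order s) auto
      have c1Z: "0 \<le> c1 * Z\<^sup>2" using s by (simp add: c1_def)
      have "m * d \<le> V"
        using mult_right_mono[OF m(2) d(1)] V B2 c1Z sR by linarith
      moreover have "m * R \<le> V"
        using mult_right_mono[OF m(4) R] V B2 c1Z sd by linarith
      moreover have "m * (t\<^sup>2)\<^sup>2 \<le> c1 * Z\<^sup>2"
        using m Z by (intro mult_mono power_mono) auto
      then have "m * (t\<^sup>2)\<^sup>2 \<le> V" using V B2 sd sR by linarith
      ultimately have bounds: "d \<le> V / m" "R \<le> V / m" "(t\<^sup>2)\<^sup>2 \<le> V / m"
        using m(1) by (simp_all add: pos_le_divide_eq mult.commute)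
      have V0: "0 \<le> V / m" using bounds(1) d by linarith
      have t2: "t\<^sup>2 \<le> (1/2)\<^sup>2" using Z False by (simp add: power2_eq_square)
      have t_half: "t \<le> 1/2" by (rule power2_le_imp_le[OF t2]) simp
      \<comment> \<open>As \<open>V / m\<close> may be 0, the positive number \<open>l\<close> comes from an arbitrary \<open>v > V / m\<close>.\<close>
      have "H powr s / (C0 powr s * X powr s) \<le> V / m"
      proof (rule dense_ge)
        fix v assume v: "V / m < v"
        define l where "l = sqrt (min 1 v)"
        have v0: "0 < v" using V0 v by (rule le_less_trans)
        have l2: "l\<^sup>2 = min 1 v" using v0 by (simp add: l_def)
        have l: "0 < l" "l \<le> 1" using v0 by (auto simp: l_def)
        have "(t\<^sup>2)\<^sup>2 \<le> 1" using power_mono[OF t2, of 2] by (simp add: power_divide)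
        moreover have "(t\<^sup>2)\<^sup>2 \<le> v" using bounds(3) v by linarith
        ultimately have t4: "(t\<^sup>2)\<^sup>2 \<le> l\<^sup>2" unfolding l2 by simp
        have "t\<^sup>2 \<le> l" by (rule power2_le_imp_le[OF t4]) (use l in simp)
        moreover have "d \<le> v" using bounds(1) v by linarith
        then have "d \<le> l\<^sup>2" unfolding l2 using d by simp
        moreover have "A / X - 1 - t\<^sup>2 \<le> l\<^sup>2"
        proof -
          have "R \<le> Z" by (simp add: Z_def)
          then have "R \<le> 1" using False by linarith
          moreover have "R \<le> v" using bounds(2) v by linarith
          ultimately show ?thesis unfolding l2 R_def[symmetric] by simp
        qed
        ultimately have "H \<le> C0 * X * l powr (2 / s)" by (rule H2[rule_format, OF l t_half])
        then have "H powr s \<le> (C0 * X * l powr (2 / s)) powr s" using H s by (intro powr_mono2) auto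
        also have "\<dots> = C0 powr s * X powr s * l\<^sup>2"
          using C0 X l s by (simp add: powr_mult powr_powr powr_numeral)
        also have "\<dots> \<le> C0 powr s * X powr s * v"
          unfolding l2 by (intro mult_left_mono) auto
        finally show "H powr s / (C0 powr s * X powr s) \<le> v"
          using C0 X by (simp add: pos_divide_le_eq mult_ac)
      qed
      then have "H powr s \<le> C2 * (X powr s * V)"
        using C0 X m(1) by (simp add: C2_def pos_divide_le_eq mult_ac)
      also have "\<dots> \<le> (C1 + C2) * (X powr s * V)"
      proof -
        have "0 \<le> V" using V0 m(1) by (simp add: zero_le_divide_iff)
        then show ?thesis using C1 by (intro mult_right_mono) auto
      qed
      finally show ?thesis unfolding V_eq .
    qed
  qed
qed

text \<open>
  Here \<open>a0\<close> and \<open>a1\<close> are the value and the derivative of \<open>B * exp L\<close> at 0.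
\<close>

lemma stability_inner_times_exp:
  fixes p :: real
  assumes p: "0 < p" "p < 2"
  obtains C where "0 < C"
    "\<forall>B L b a0 a1. B holomorphic_on cball 0 1 \<longrightarrow>
       (\<forall>z. cmod z = 1 \<longrightarrow> cmod (B z) = 1) \<longrightarrow>
       L holomorphic_on cball 0 1 \<longrightarrow>
       b = of_real (p / 2) * deriv L 0 \<longrightarrow>
       a0 = B 0 * exp (L 0) \<longrightarrow>
       a1 = exp (L 0) * (deriv B 0 + B 0 * (of_real (2 / p) * b))
       \<longrightarrow> circle_average (\<lambda>z. cmod (B z * exp (L z) - a0 - a1 * z) powr p) powr (2 / p)
         \<le> C * (circle_average (\<lambda>z. exp (p * Re (L z))) powr (2 / p) - (cmod a0)\<^sup>2 - p / 2 * (cmod a1)\<^sup>2)"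
proof -
  define s where "s = 2 / p"
  have s: "1 < s" "2 / s = p" "1 / s = p / 2" using p by (auto simp: s_def)
  obtain C0 where C0: "0 < C0"
    "\<forall>B L b l. B holomorphic_on cball 0 1 \<longrightarrow>
       (\<forall>z. cmod z = 1 \<longrightarrow> cmod (B z) = 1) \<longrightarrow>
       L holomorphic_on cball 0 1 \<longrightarrow>
       b = of_real (p / 2) * deriv L 0 \<longrightarrow>
       cmod b \<le> 1/2 \<longrightarrow>
       0 < l \<longrightarrow>
       l \<le> 1 \<longrightarrow>
       (cmod b)\<^sup>2 \<le> l \<longrightarrow>
       1 - (cmod (B 0))\<^sup>2 \<le> l\<^sup>2 \<longrightarrow>
       circle_average (\<lambda>z. exp (p * Re (L z))) / exp (p * Re (L 0)) - 1 - (cmod b)\<^sup>2 \<le> l\<^sup>2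
       \<longrightarrow> circle_average (\<lambda>z. cmod (B z * exp (L z) - B 0 * exp (L 0)
            - exp (L 0) * (deriv B 0 + B 0 * (of_real (2 / p) * b)) * z) powr p)
         \<le> C0 * exp (p * Re (L 0)) * l powr p"
    by (rule near_constant_remainder_bound[OF p(1) less_imp_le[OF p(2)]], rule that)
  obtain C where C: "0 < C"
    "\<forall>X A H d t a. 0 < X \<longrightarrow>
       0 \<le> H \<longrightarrow>
       0 \<le> d \<longrightarrow>
       d \<le> 1 \<longrightarrow>
       0 \<le> t \<longrightarrow>
       0 \<le> a \<longrightarrow>
       a \<le> d + sqrt (1 - d) * s * t \<longrightarrow>
       X * (1 + t\<^sup>2) \<le> A \<longrightarrow>
       H \<le> 9 * (A + X + a powr (2 / s) * X) \<longrightarrow>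
       (\<forall>l. 0 < l \<longrightarrow> l \<le> 1 \<longrightarrow> t \<le> 1/2 \<longrightarrow> t\<^sup>2 \<le> l \<longrightarrow> d \<le> l\<^sup>2 \<longrightarrow> A / X - 1 - t\<^sup>2 \<le> l\<^sup>2
          \<longrightarrow> H \<le> C0 * X * l powr (2 / s))
       \<longrightarrow> H powr s \<le> C * (A powr s - (1 - d) * X powr s - a\<^sup>2 / s * X powr s)"
    by (rule deficit_dominates[OF s(1) C0(1)], rule that)
  show thesis
  proof (rule that[OF C(1)], intro allI impI)
    fix B L b a0 a1
    assume B': "B holomorphic_on cball 0 1" "\<forall>z. cmod z = 1 \<longrightarrow> cmod (B z) = 1"
      and L: "L holomorphic_on cball 0 1" and b: "b = of_real (p / 2) * deriv L 0"
      and a0: "a0 = B 0 * exp (L 0)"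
      and a1: "a1 = exp (L 0) * (deriv B 0 + B 0 * (of_real (2 / p) * b))"
    note B = B'(1) B'(2)[rule_format]
    note cB [continuous_intros] = continuous_on_circle[OF B(1)]
    note cL [continuous_intros] = continuous_on_circle[OF L]
    define X where "X = exp (p * Re (L 0))"
    define A where "A = circle_average (\<lambda>z. exp (p * Re (L z)))"
    define H where "H = circle_average (\<lambda>z. cmod (B z * exp (L z) - a0 - a1 * z) powr p)"
    define d where "d = 1 - (cmod (B 0))\<^sup>2"
    define a where "a = cmod (deriv B 0 + B 0 * (of_real s * b))"
    have B0: "cmod (B 0) \<le> 1" "cmod (deriv B 0) \<le> d"
      using inner_deriv_bound[OF B] unfolding d_def by blast+
    have d: "0 \<le> d" "d \<le> 1" using B0(1) by (auto simp: d_def power_le_one)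
    have X: "0 < X" by (simp add: X_def)
    have XeL: "X = cmod (exp (L 0)) powr p" by (simp only: X_def cmod_exp_powr)
    have Xs: "X powr s = (cmod (exp (L 0)))\<^sup>2"
      unfolding XeL using p by (simp add: powr_powr s_def powr_numeral del: norm_exp_eq_Re)
    have n0: "(cmod a0)\<^sup>2 = (1 - d) * X powr s"
      unfolding a0 Xs by (simp add: norm_mult power_mult_distrib d_def)
    have n1: "cmod a1 = cmod (exp (L 0)) * a" by (simp only: a1 norm_mult a_def s_def)
    have n1': "p / 2 * (cmod a1)\<^sup>2 = a\<^sup>2 / s * X powr s"
      unfolding n1 Xs using p by (simp add: power_mult_distrib s_def)
    have H0: "0 \<le> H" unfolding H_def
      by (intro circle_average_nonneg continuous_on_powr' continuous_intros) (use p in auto)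
    have "H powr s \<le> C * (A powr s - (1 - d) * X powr s - a\<^sup>2 / s * X powr s)"
    proof (rule C(2)[rule_format, OF X H0 d, of "cmod b"])
      have "a \<le> cmod (deriv B 0) + cmod (B 0) * (s * cmod b)"
        unfolding a_def using norm_triangle_ineq[of "deriv B 0" "B 0 * (of_real s * b)"] s(1)
        by (simp add: norm_mult)
      also have "cmod (B 0) = sqrt (1 - d)" by (simp add: d_def)
      finally show "a \<le> d + sqrt (1 - d) * s * cmod b" using B0(2) by simp
      have nb: "cmod b = p / 2 * cmod (deriv L 0)" using p by (simp add: b norm_mult)
      show "X * (1 + (cmod b)\<^sup>2) \<le> A"
        unfolding X_def A_def nb by (rule average_exp_lower_bound[OF L])
      have a0p: "cmod a0 powr p \<le> X"
        unfolding a0 XeL norm_mult using B0(1) p by (intro powr_mono2) (auto intro: mult_left_le_one_le)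
      have a1p: "cmod a1 powr p = a powr (2 / s) * X"
        unfolding n1 XeL s(2) by (simp add: powr_mult a_def)
      have "H \<le> circle_average (\<lambda>z. 9 * (exp (p * Re (L z)) + (X + a powr (2 / s) * X)))"
        unfolding H_def
      proof (rule circle_average_mono)
        fix z :: complex assume z: "cmod z = 1"
        have "cmod (B z * exp (L z) - a0 - a1 * z) \<le> cmod (exp (L z)) + cmod a0 + cmod a1"
          using norm_triangle_ineq4[of "B z * exp (L z) - a0" "a1 * z"] norm_triangle_ineq4[of "B z * exp (L z)" a0]
          by (simp add: norm_mult B(2)[OF z] z)
        then have "cmod (B z * exp (L z) - a0 - a1 * z) powr p \<le> (cmod (exp (L z)) + cmod a0 + cmod a1) powr p"
          using p by (intro powr_mono2) auto
        also have "\<dots> \<le> 9 * (cmod (exp (L z)) powr p + cmod a0 powr p + cmod a1 powr p)"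
          using p by (intro powr_add3_le) auto
        also have "\<dots> \<le> 9 * (exp (p * Re (L z)) + (X + a powr (2 / s) * X))"
          unfolding a1p cmod_exp_powr using a0p by simp
        finally show "cmod (B z * exp (L z) - a0 - a1 * z) powr p \<le> 9 * (exp (p * Re (L z)) + (X + a powr (2 / s) * X))" .
      next
        show "continuous_on (sphere 0 1) (\<lambda>z. cmod (B z * exp (L z) - a0 - a1 * z) powr p)"
          by (intro continuous_on_powr' continuous_intros) (use p in auto)
      qed (intro continuous_intros)
      also have "\<dots> = 9 * (A + (X + a powr (2 / s) * X))"
        unfolding A_def
        by (subst circle_average_mult_left, subst circle_average_add) (intro continuous_intros | simp)+
      finally show "H \<le> 9 * (A + X + a powr (2 / s) * X)" by (simp add: algebra_simps)
    next
      fix l assume "0 < l" "l \<le> 1" "cmod b \<le> 1/2" "(cmod b)\<^sup>2 \<le> l" "d \<le> l\<^sup>2" "A / X - 1 - (cmod b)\<^sup>2 \<le> l\<^sup>2"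
      then show "H \<le> C0 * X * l powr (2 / s)"
        unfolding H_def X_def A_def a0 a1 d_def s(2) by (intro C0(2)[rule_format, OF B L b])
    qed (auto simp: a_def)
    then show "circle_average (\<lambda>z. cmod (B z * exp (L z) - a0 - a1 * z) powr p) powr (2 / p)
         \<le> C * (circle_average (\<lambda>z. exp (p * Re (L z))) powr (2 / p) - (cmod a0)\<^sup>2 - p / 2 * (cmod a1)\<^sup>2)"
      unfolding n0 n1' by (simp only: H_def A_def s_def)
  qed
qed

text \<open>
  The case \<open>p = 2\<close> is Parseval's identity. The argument for \<open>p < 2\<close> divides by the positive
  coefficient \<open>1 - p / 2\<close> of \<open>d\<close> in the lower bound for the deficit.
\<close>

lemma stability_on_circle:
  fixes p :: real
  assumes p: "0 < p" "p \<le> 2"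
  obtains C where "0 < C"
    "\<forall>f. f holomorphic_on cball 0 1 \<longrightarrow>
       (\<forall>z. cmod z = 1 \<longrightarrow> f z \<noteq> 0) \<longrightarrow>
       finite {z \<in> ball 0 1. f z = 0}
       \<longrightarrow> circle_average (\<lambda>z. cmod (f z - f 0 - deriv f 0 * z) powr p) powr (2 / p)
         \<le> C * (circle_average (\<lambda>z. cmod (f z) powr p) powr (2 / p) - (cmod (f 0))\<^sup>2 - p / 2 * (cmod (deriv f 0))\<^sup>2)"
proof (cases "p = 2")
  case True
  show ?thesis
  proof (rule that[of 1]; (intro allI impI)?)
    fix f assume f: "f holomorphic_on cball 0 1"
    note cf [continuous_intros] = continuous_on_circle[OF f]
    have p2: "x powr p = x\<^sup>2" if "0 \<le> x" for x using that by (cases "x = 0") (simp_all add: True powr_numeral)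
    have "0 \<le> circle_average (\<lambda>z. (cmod (f z - f 0 - deriv f 0 * z))\<^sup>2)"
      "0 \<le> circle_average (\<lambda>z. (cmod (f z))\<^sup>2)"
      by (intro circle_average_nonneg continuous_intros, simp)+
    then show "circle_average (\<lambda>z. cmod (f z - f 0 - deriv f 0 * z) powr p) powr (2 / p)
         \<le> 1 * (circle_average (\<lambda>z. cmod (f z) powr p) powr (2 / p) - (cmod (f 0))\<^sup>2 - p / 2 * (cmod (deriv f 0))\<^sup>2)"
      using average_square_minus_Taylor[OF f, of "f 0" "deriv f 0"] by (simp add: p2 True)
  qed auto
next
  case False
  then have p': "0 < p" "p < 2" using p by auto
  obtain C where C: "0 < C"
    "\<forall>B L b a0 a1. B holomorphic_on cball 0 1 \<longrightarrow>
       (\<forall>z. cmod z = 1 \<longrightarrow> cmod (B z) = 1) \<longrightarrow>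
       L holomorphic_on cball 0 1 \<longrightarrow>
       b = of_real (p / 2) * deriv L 0 \<longrightarrow>
       a0 = B 0 * exp (L 0) \<longrightarrow>
       a1 = exp (L 0) * (deriv B 0 + B 0 * (of_real (2 / p) * b))
       \<longrightarrow> circle_average (\<lambda>z. cmod (B z * exp (L z) - a0 - a1 * z) powr p) powr (2 / p)
         \<le> C * (circle_average (\<lambda>z. exp (p * Re (L z))) powr (2 / p) - (cmod a0)\<^sup>2 - p / 2 * (cmod a1)\<^sup>2)"
    by (rule stability_inner_times_exp[OF p'], rule that)
  show ?thesis
  proof (rule that[OF C(1)], intro allI impI)
    fix f :: "complex \<Rightarrow> complex"
    assume f': "f holomorphic_on cball 0 1" "\<forall>z. cmod z = 1 \<longrightarrow> f z \<noteq> 0" "finite {z \<in> ball 0 1. f z = 0}"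
    note f = f'(1) f'(2)[rule_format] f'(3)
    obtain B L where BL: "B holomorphic_on cball 0 1" "L holomorphic_on cball 0 1"
      "\<And>z. cmod z = 1 \<Longrightarrow> cmod (B z) = 1" "\<And>z. z \<in> cball 0 1 \<Longrightarrow> f z = B z * exp (L z)"
      by (rule inner_times_exp_factorization[OF f], assumption, rule that)
    define b where "b = of_real (p / 2) * deriv L 0"
    have a0: "f 0 = B 0 * exp (L 0)" using BL(4)[of 0] by simp
    have "((\<lambda>z. B z * exp (L z)) has_field_derivative
        (B 0 * (exp (L 0) * deriv L 0) + deriv B 0 * exp (L 0))) (at 0)"
      by (rule DERIV_mult'[OF holomorphic_at_0[OF BL(1)] DERIV_chain2[OF DERIV_exp holomorphic_at_0[OF BL(2)]]])
    then have "(f has_field_derivative (B 0 * (exp (L 0) * deriv L 0) + deriv B 0 * exp (L 0))) (at 0)"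
      by (rule has_field_derivative_transform_within_open[of _ _ _ "ball 0 1"]) (use BL(4) in auto)
    then have "deriv f 0 = B 0 * (exp (L 0) * deriv L 0) + deriv B 0 * exp (L 0)" by (rule DERIV_imp_deriv)
    moreover have "of_real (2 / p) * b = deriv L 0" using p by (simp add: b_def)
    ultimately have a1: "deriv f 0 = exp (L 0) * (deriv B 0 + B 0 * (of_real (2 / p) * b))"
      by (simp add: algebra_simps)
    have "circle_average (\<lambda>z. cmod (f z - f 0 - deriv f 0 * z) powr p)
        = circle_average (\<lambda>z. cmod (B z * exp (L z) - f 0 - deriv f 0 * z) powr p)"
      by (rule circle_average_cong) (simp add: BL(4))
    moreover have "circle_average (\<lambda>z. cmod (f z) powr p) = circle_average (\<lambda>z. exp (p * Re (L z)))"
      by (rule circle_average_cong) (simp add: BL(3,4) norm_mult powr_def)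
    ultimately show "circle_average (\<lambda>z. cmod (f z - f 0 - deriv f 0 * z) powr p) powr (2 / p)
         \<le> C * (circle_average (\<lambda>z. cmod (f z) powr p) powr (2 / p) - (cmod (f 0))\<^sup>2 - p / 2 * (cmod (deriv f 0))\<^sup>2)"
      using C(2)[rule_format, OF BL(1,3,2) b_def a0 a1] by simp
  qed
qed

section \<open>Hardy norms\<close>

lemma circle_mean_eq_average:
  assumes f: "f holomorphic_on ball 0 1" and r: "0 < r" "r < 1" and p: "0 < p"
  shows "circle_mean p f r = circle_average (\<lambda>z. cmod (f (of_real r * z)) powr p) powr (1 / p)"
proof -
  have "continuous_on {0..2*pi} (\<lambda>t. cmod (f (of_real r * cis t)) powr p)"
    by (intro continuous_on_powr' continuous_intros
        continuous_on_compose2[OF holomorphic_on_imp_continuous_on[OF f]])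
       (use r p in \<open>auto simp: norm_mult\<close>)
  then have "(LINT t:{0..2*pi}|lborel. cmod (f (of_real r * cis t)) powr p)
      = integral {0..2*pi} (\<lambda>t. cmod (f (of_real r * cis t)) powr p)"
    by (intro set_borel_integral_eq_integral borel_integrable_atLeastAtMost')
  then show ?thesis
    by (simp add: circle_mean_def circle_average_def field_simps)
qed

lemma dilation_holomorphic:
  assumes f: "f holomorphic_on ball 0 1" and r: "0 < r" "r < 1"
  shows "(\<lambda>z. f (of_real r * z)) holomorphic_on cball 0 1"
    and "deriv (\<lambda>z. f (of_real r * z)) 0 = of_real r * deriv f 0"
proof -
  have "f \<circ> (\<lambda>z. of_real r * z) holomorphic_on cball 0 1"
  proof (rule holomorphic_on_compose_gen[OF _ f])
    show "(*) (of_real r) ` cball 0 1 \<subseteq> (ball 0 1 :: complex set)"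
    proof (rule image_subsetI)
      fix z :: complex assume "z \<in> cball 0 1"
      then have "r * cmod z \<le> r" using r by (simp add: mult_left_le)
      then have "r * cmod z < 1" using r by linarith
      then show "of_real r * z \<in> ball 0 1" using r by (simp add: norm_mult)
    qed
  qed (intro holomorphic_intros)
  then show "(\<lambda>z. f (of_real r * z)) holomorphic_on cball 0 1" by (simp add: o_def)
  have "(f has_field_derivative deriv f 0) (at (of_real r * 0))"
    using holomorphic_derivI[OF f open_ball, of 0] by simp
  from DERIV_chain2[OF this DERIV_cmult[OF DERIV_ident]]
  have "((\<lambda>z. f (of_real r * z)) has_field_derivative of_real r * deriv f 0) (at 0)"
    by (simp add: mult.commute)
  then show "deriv (\<lambda>z. f (of_real r * z)) 0 = of_real r * deriv f 0"
    by (rule DERIV_imp_deriv)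
qed

lemma finite_zeros_in_smaller_disc:
  assumes u: "u holomorphic_on ball 0 1" and nz: "\<exists>z\<in>ball 0 1. u z \<noteq> 0" and r: "r < 1"
  shows "finite {z \<in> cball 0 r. u z = 0}"
proof (cases "u constant_on ball 0 1")
  case True
  then obtain c where c: "\<And>z. z \<in> ball 0 1 \<Longrightarrow> u z = c" unfolding constant_on_def by auto
  then have "c \<noteq> 0" using nz by auto
  then have "{z \<in> cball 0 r. u z = 0} = {}" using c r by auto
  then show ?thesis by (simp only: finite.emptyI)
next
  case False
  then show ?thesis
    using r by (intro holomorphic_compact_finite_zeros[OF u]) auto
qed

text \<open>
  Only finitely many radii below a fixed \<open>R1 < 1\<close> are moduli of zeros.
\<close>

lemma zero_free_radius:
  fixes u :: "complex \<Rightarrow> complex"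
  assumes fin: "\<And>R. R < 1 \<Longrightarrow> finite {z \<in> cball 0 R. u z = 0}" and r: "r < 1"
  obtains R where "r < R" "R < 1" "\<And>z. cmod z = R \<Longrightarrow> u z \<noteq> 0"
proof -
  define R1 where "R1 = (r + 1) / 2"
  have R1: "r < R1" "R1 < 1" using r by (auto simp: R1_def)
  let ?N = "cmod ` {z \<in> cball 0 R1. u z = 0}"
  have "infinite ({r<..<R1} - ?N)"
    using fin[OF R1(2)] R1(1) infinite_Ioo[of r R1] by (simp add: Diff_infinite_finite)
  then have "{r<..<R1} - ?N \<noteq> {}" by (metis finite.emptyI)
  then obtain R where "R \<in> {r<..<R1} - ?N" by (rule ex_in_conv[THEN iffD2, THEN exE])
  then have R: "r < R" "R < R1" "R \<notin> ?N"
    by (simp_all only: Diff_iff greaterThanLessThan_iff not_False_eq_True)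
  show thesis
  proof (rule that[of R])
    show "u z \<noteq> 0" if "cmod z = R" for z
    proof
      assume "u z = 0"
      then have "z \<in> {z \<in> cball 0 R1. u z = 0}" using R(2) that by simp
      then show False using R(3) that by blast
    qed
  qed (use R R1 in auto)
qed

lemma finite_zeros_dilation:
  fixes u :: "complex \<Rightarrow> complex"
  assumes "finite {z \<in> cball 0 r. u z = 0}" "0 < r"
  shows "finite {z \<in> ball 0 1. u (of_real r * z) = 0}"
proof (rule finite_subset)
  show "{z \<in> ball 0 1. u (of_real r * z) = 0} \<subseteq> (\<lambda>w. w / of_real r) ` {z \<in> cball 0 r. u z = 0}"
  proof
    fix z assume "z \<in> {z \<in> ball 0 1. u (of_real r * z) = 0}"
    then show "z \<in> (\<lambda>w. w / of_real r) ` {z \<in> cball 0 r. u z = 0}"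
      using assms(2) by (intro image_eqI[of _ _ "of_real r * z"]) (auto simp: norm_mult)
  qed
  show "finite ((\<lambda>w. w / of_real r) ` {z \<in> cball 0 r. u z = 0})" using assms(1) by (rule finite_imageI)
qed

lemma circle_mean_mono:
  assumes h: "h holomorphic_on ball 0 1" and nz: "\<And>z. cmod z = r \<Longrightarrow> h z \<noteq> 0"
    and fin: "finite {z \<in> cball 0 r. h z = 0}" and r: "0 < \<rho>" "\<rho> \<le> r" "r < 1" and p: "0 < p"
  shows "circle_mean p h \<rho> \<le> circle_mean p h r"
proof -
  have r0: "0 < r" using r by simp
  have eq: "of_real r * (of_real (\<rho> / r) * z) = of_real \<rho> * z" for z :: complex using r by simp
  have "circle_average (\<lambda>z. cmod (h (of_real r * (of_real (\<rho> / r) * z))) powr p)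
      \<le> circle_average (\<lambda>z. cmod (h (of_real r * z)) powr p)"
    by (rule average_powr_dilation_le[of "\<lambda>z. h (of_real r * z)"])
       (use dilation_holomorphic(1)[OF h r0 r(3)] finite_zeros_dilation[OF fin r0] nz r p
         in \<open>auto simp: norm_mult\<close>)
  moreover have "0 \<le> circle_average (\<lambda>z. cmod (h (of_real \<rho> * z)) powr p)"
    by (rule circle_average_nonneg[OF continuous_on_powr'])
       (use p r in \<open>auto intro!: continuous_intros continuous_on_circle dilation_holomorphic(1)[OF h]\<close>)
  ultimately show ?thesis
    using r p unfolding eq by (simp add: circle_mean_eq_average[OF h] powr_mono2)
qed

theorem theorem1p4:
  fixes p :: real
  assumes "0 < p" and "p \<le> 2"
  shows "\<exists>C::real. \<forall>f\<in>hardy_space p.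
           (hardy_norm p (\<lambda>z. f z - f 0 - deriv f 0 * z))\<^sup>2
             \<le> C * ((hardy_norm p f)\<^sup>2 - (cmod (f 0))\<^sup>2 - p / 2 * (cmod (deriv f 0))\<^sup>2)"
proof -
  obtain C where C: "0 < C"
    "\<forall>f. f holomorphic_on cball 0 1 \<longrightarrow> (\<forall>z. cmod z = 1 \<longrightarrow> f z \<noteq> 0) \<longrightarrow> finite {z \<in> ball 0 1. f z = 0}
     \<longrightarrow> circle_average (\<lambda>z. cmod (f z - f 0 - deriv f 0 * z) powr p) powr (2 / p)
         \<le> C * (circle_average (\<lambda>z. cmod (f z) powr p) powr (2 / p) - (cmod (f 0))\<^sup>2 - p / 2 * (cmod (deriv f 0))\<^sup>2)"
    by (rule stability_on_circle[OF assms], rule that)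
  show ?thesis
  proof (intro exI[of _ C] ballI)
    fix f assume "f \<in> hardy_space p"
    then have f: "f holomorphic_on ball 0 1" and bdd: "bdd_above (circle_mean p f ` {0<..<1})"
      by (auto simp: hardy_space_def)
    define h where "h = (\<lambda>z. f z - f 0 - deriv f 0 * z)"
    have h: "h holomorphic_on ball 0 1" unfolding h_def by (intro holomorphic_intros f)
    define N where "N = hardy_norm p f"
    have N: "circle_mean p f r \<le> N" if "0 < r" "r < 1" for r
      unfolding N_def hardy_norm_def using bdd that by (intro cSUP_upper) auto
    have mean0: "0 \<le> circle_mean p g r" for g r by (simp add: circle_mean_def)
    have mean_zero: "circle_mean p g r = 0" if "\<And>z. z \<in> ball 0 1 \<Longrightarrow> g z = 0" "0 < r" "r < 1" for g r
      using that by (simp add: circle_mean_def norm_mult)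
    have N0: "0 \<le> N" using order_trans[OF mean0 N[of "1/2"]] by simp
    define Q where "Q = (\<lambda>r. C * (N\<^sup>2 - (cmod (f 0))\<^sup>2 - p / 2 * (r\<^sup>2 * (cmod (deriv f 0))\<^sup>2)))"
    have square: "(x powr (1 / p))\<^sup>2 = x powr (2 / p)" for x :: real
      by (simp add: power2_eq_square flip: powr_add)
    have main: "(circle_mean p h \<rho>)\<^sup>2 \<le> Q r" if \<rho>: "0 < \<rho>" "\<rho> \<le> r" "r < 1" for \<rho> r
    proof (cases "\<forall>z\<in>ball 0 1. f z = 0")
      case True
      have "eventually (\<lambda>z. z \<in> ball 0 (1::real)) (nhds (0::complex))"
        by (rule eventually_nhds_in_open) auto
      then have "eventually (\<lambda>z. f z = 0) (nhds 0)" by eventually_elim (use True in auto)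
      then have "deriv f 0 = deriv (\<lambda>_. 0) 0" by (rule deriv_cong_ev) simp
      then have d0: "deriv f 0 = 0" by simp
      have "circle_mean p h \<rho> = 0"
        using True d0 \<rho> by (intro mean_zero) (auto simp: h_def)
      then show ?thesis using d0 True C(1) by (simp add: Q_def)
    next
      case False
      have finf: "finite {z \<in> cball 0 R. f z = 0}" if "R < 1" for R
        using False that by (intro finite_zeros_in_smaller_disc[OF f]) auto
      define hzero where "hzero = (\<forall>z\<in>ball 0 1. h z = 0)"
      have finh: "finite {z \<in> cball 0 R. h z = 0}" if "R < 1" "\<not> hzero" for R
        using that by (intro finite_zeros_in_smaller_disc[OF h]) (auto simp: hzero_def)
      \<comment> \<open>The radius \<open>R\<close> has to avoid the zeros of \<open>f\<close> and, unless \<open>h\<close> vanishes identically, those of \<open>h\<close>.\<close>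
      define u where "u = (\<lambda>z. if hzero then f z else f z * h z)"
      have finu: "finite {z \<in> cball 0 R. u z = 0}" if "R < 1" for R
      proof (rule finite_subset)
        show "{z \<in> cball 0 R. u z = 0} \<subseteq> {z \<in> cball 0 R. f z = 0} \<union> {z \<in> cball 0 R. \<not> hzero \<and> h z = 0}"
          by (auto simp: u_def split: if_splits)
        show "finite ({z \<in> cball 0 R. f z = 0} \<union> {z \<in> cball 0 R. \<not> hzero \<and> h z = 0})"
          using finf[OF that] finh[OF that] by (cases hzero) auto
      qed
      obtain R where R: "r < R" "R < 1" "\<And>z. cmod z = R \<Longrightarrow> u z \<noteq> 0"
        by (rule zero_free_radius[OF finu \<rho>(3)], assumption, rule that)
      have R0: "0 < R" using \<rho> R by simp
      have nzf: "f z \<noteq> 0" if "cmod z = R" for z using R(3)[OF that] by (auto simp: u_def split: if_splits)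
      have le_R: "circle_mean p h \<rho> \<le> circle_mean p h R"
      proof (cases hzero)
        case True
        then have "circle_mean p h \<rho> = 0" using \<rho> by (intro mean_zero) (auto simp: hzero_def)
        then show ?thesis using mean0 by simp
      next
        case False
        have "h z \<noteq> 0" if "cmod z = R" for z using R(3)[OF that] False by (auto simp: u_def)
        then show ?thesis
          by (rule circle_mean_mono[OF h _ finh[OF R(2) False]]) (use \<rho> R assms in auto)
      qed
      define F where "F = (\<lambda>z. f (of_real R * z))"
      have F: "F holomorphic_on cball 0 1" "deriv F 0 = of_real R * deriv f 0"
        unfolding F_def by (rule dilation_holomorphic[OF f R0 R(2)])+
      have hF: "h (of_real R * z) = F z - F 0 - deriv F 0 * z" for z
        by (simp add: h_def F(2)) (simp add: F_def)
      have "(circle_mean p h \<rho>)\<^sup>2 \<le> (circle_mean p h R)\<^sup>2"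
        using le_R mean0 by (intro power_mono) auto
      also have "\<dots> = circle_average (\<lambda>z. cmod (F z - F 0 - deriv F 0 * z) powr p) powr (2 / p)"
        unfolding circle_mean_eq_average[OF h R0 R(2) assms(1)] square hF ..
      also have "\<dots> \<le> C * (circle_average (\<lambda>z. cmod (F z) powr p) powr (2 / p)
          - (cmod (F 0))\<^sup>2 - p / 2 * (cmod (deriv F 0))\<^sup>2)"
      proof (rule C(2)[rule_format, OF F(1)])
        show "F z \<noteq> 0" if "cmod z = 1" for z
          using nzf[of "of_real R * z"] that R0 by (simp add: F_def norm_mult)
        show "finite {z \<in> ball 0 1. F z = 0}"
          unfolding F_def by (rule finite_zeros_dilation[OF finf[OF R(2)] R0])
      qed
      also have "circle_average (\<lambda>z. cmod (F z) powr p) powr (2 / p) = (circle_mean p f R)\<^sup>2"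
        unfolding circle_mean_eq_average[OF f R0 R(2) assms(1)] square F_def ..
      also have "C * ((circle_mean p f R)\<^sup>2 - (cmod (F 0))\<^sup>2 - p / 2 * (cmod (deriv F 0))\<^sup>2) \<le> Q r"
      proof -
        have "(circle_mean p f R)\<^sup>2 \<le> N\<^sup>2" using N[OF R0 R(2)] mean0 by (intro power_mono) auto
        moreover have "r\<^sup>2 * (cmod (deriv f 0))\<^sup>2 \<le> (cmod (deriv F 0))\<^sup>2"
          unfolding F(2) norm_mult power_mult_distrib using R \<rho>
          by (intro mult_right_mono) (auto intro!: power_mono)
        then have "p / 2 * (r\<^sup>2 * (cmod (deriv f 0))\<^sup>2) \<le> p / 2 * (cmod (deriv F 0))\<^sup>2"
          using assms by (intro mult_left_mono) auto
        moreover have "F 0 = f 0" by (simp add: F_def)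
        ultimately show ?thesis
          unfolding Q_def using C(1) by (intro mult_left_mono) auto
      qed
      finally show ?thesis .
    qed
    have bound: "(circle_mean p h \<rho>)\<^sup>2 \<le> Q 1" if \<rho>: "0 < \<rho>" "\<rho> < 1" for \<rho>
    proof (rule tendsto_lowerbound)
      show "(Q \<longlongrightarrow> Q 1) (at_left 1)"
        unfolding Q_def by (intro tendsto_intros)
      show "eventually (\<lambda>r. (circle_mean p h \<rho>)\<^sup>2 \<le> Q r) (at_left 1)"
        using \<rho> by (intro eventually_at_leftI[of \<rho>] main) auto
    qed auto
    have Q1: "0 \<le> Q 1" using order_trans[OF zero_le_power2 bound[of "1/2"]] by simp
    have root: "circle_mean p h \<rho> \<le> sqrt (Q 1)" if "0 < \<rho>" "\<rho> < 1" for \<rho>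
      using bound[OF that] by (rule real_le_rsqrt)
    have "bdd_above (circle_mean p h ` {0<..<1})"
      by (rule bdd_aboveI[of _ "sqrt (Q 1)"]) (use root in auto)
    then have "circle_mean p h (1/2) \<le> hardy_norm p h"
      unfolding hardy_norm_def by (intro cSUP_upper) auto
    then have "0 \<le> hardy_norm p h" using mean0 by (rule order_trans[rotated])
    moreover have "hardy_norm p h \<le> sqrt (Q 1)"
      unfolding hardy_norm_def by (rule cSUP_least) (use root in auto)
    ultimately have "(hardy_norm p h)\<^sup>2 \<le> (sqrt (Q 1))\<^sup>2" by (intro power_mono)
    also have "\<dots> = Q 1" using Q1 by simp
    finally show "(hardy_norm p (\<lambda>z. f z - f 0 - deriv f 0 * z))\<^sup>2
        \<le> C * ((hardy_norm p f)\<^sup>2 - (cmod (f 0))\<^sup>2 - p / 2 * (cmod (deriv f 0))\<^sup>2)"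
      unfolding h_def Q_def N_def by simp
  qed
qed

end
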